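(* Let $(Z_n)_{n\ge 0}$ be a branching process in a stationary and ergodic random environment $\xi=(\xi_0,\xi_1,\dots)$ with finite state space, i.e. each $\xi_n$ takes values in a finite set $\{a_1,a_2,\dots,a_N\}$. Assume that $p_0(\xi_0)=0$ and $p_1(\xi_0)<1$ a.s. Let $W_n=Z_n/\Pi_n$ and $W=\lim_{n\to\infty}W_n$ a.s. Then: (a) $\mathbb{E}e^{\theta W}<\infty$ for some $\theta>0$ if and only if $\mathbb{E}e^{\theta_0W_1}<\infty$ for some $\theta_0>0$. (b) If $\mathbb{E}e^{\theta_0W_1}<\infty$ for some constant $\theta_0>0$, then there exist constants $\gamma>0$ and $C>0$ such that, for all $n\ge 0$ and all $\varepsilon>0$, $$\mathbb{P}_\xi(|W-W_n|>\varepsilon)\le C\exp\left(-\gamma\,\Pi_n^{1/3}\varepsilon^{2/3}\right)\quad\text{a.s.},$$ and $$\mathbb{P}(|W-W_n|>\varepsilon)\le C\exp\left(-\gamma\,\underline{m}^{n/3}\varepsilon^{2/3}\right),$$ where $\underline{m}:=\operatorname{ess\,inf} m_0>1$.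
   Context: Branching process in a random environment: $\xi=(\xi_0,\xi_1,\xi_2,\dots)$ is a stationary and ergodic sequence of random variables. Each realization of $\xi_n$ corresponds to a probability distribution $p(\xi_n)=\{p_i(\xi_n): i\in\mathbb{N}_0\}$ on $\mathbb{N}_0=\{0,1,2,\dots\}$ (so $p_i(\xi_n)\ge0$, $\sum_i p_i(\xi_n)=1$) with $\sum_i i\,p_i(\xi_n)\in(0,\infty)$. The process is defined by $Z_0=1$, $Z_{n+1}=\sum_{i=1}^{Z_n}X_{n,i}$ for $n\ge0$, where, conditionally on $\xi$, the random variables $X_{n,i}$ ($n\ge0$, $i\ge1$) are independent and each $X_{n,i}$ has distribution $p(\xi_n)$. $\mathbb{P}_\xi$ and $\mathbb{E}_\xi$ denote the conditional probability and expectation given $\xi$ (quenched law); $\mathbb{P}$ and $\mathbb{E}$ denote the total probability and expectation (annealed law). Notation: $m_n=\sum_{i\ge1} i\,p_i(\xi_n)$, $\Pi_0=1$, $\Pi_n=\prod_{i=0}^{n-1}m_i=\mathbb{E}_\xi Z_n$. The sequence $W_n=Z_n/\Pi_n$ is a nonnegative martingale under $\mathbb{P}_\xi$ with respect to $\mathcal{F}_n=\sigma(\xi_0,\xi_1,\dots;\,X_{k,i}, 0\le k\le n-1, i\ge1)$, and hence converges a.s. to a limit $W$.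
   Formalization: In (a), the "only if" direction is proved assuming that W is not a.s. zero; it fails otherwise (e.g. Galton–Watson with p_k proportional to 1/(k² log² k), k ≥ 2, where W = 0 a.s.). The "if" direction and (b) are proved without this assumption. *)

theory Defs
  imports "HOL-Probability.Probability"
begin

definition env_space :: "'e measure \<Rightarrow> (nat \<Rightarrow> 'e) measure" where
  "env_space E = (\<Pi>\<^sub>M n\<in>UNIV. E)"

definition env_seq :: "(nat \<Rightarrow> 'a \<Rightarrow> 'e) \<Rightarrow> 'a \<Rightarrow> nat \<Rightarrow> 'e" where
  "env_seq \<xi> \<omega> = (\<lambda>n. \<xi> n \<omega>)"

definition env_shift :: "(nat \<Rightarrow> 'e) \<Rightarrow> nat \<Rightarrow> 'e" where
  "env_shift x = (\<lambda>n. x (Suc n))"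

definition stationary :: "'a measure \<Rightarrow> 'e measure \<Rightarrow> (nat \<Rightarrow> 'a \<Rightarrow> 'e) \<Rightarrow> bool" where
  "stationary M E \<xi> \<longleftrightarrow>
     distr M (env_space E) (\<lambda>\<omega>. env_shift (env_seq \<xi> \<omega>)) = distr M (env_space E) (env_seq \<xi>)"

definition ergodic :: "'a measure \<Rightarrow> 'e measure \<Rightarrow> (nat \<Rightarrow> 'a \<Rightarrow> 'e) \<Rightarrow> bool" where
  "ergodic M E \<xi> \<longleftrightarrow>
     (\<forall>B\<in>sets (env_space E).
        env_shift -` B \<inter> space (env_space E) = B \<longrightarrow>
        measure (distr M (env_space E) (env_seq \<xi>)) B \<in> {0, 1})"

definition env_algebra :: "'a measure \<Rightarrow> 'e measure \<Rightarrow> (nat \<Rightarrow> 'a \<Rightarrow> 'e) \<Rightarrow> 'a measure" where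
  "env_algebra M E \<xi> = vimage_algebra (space M) (env_seq \<xi>) (env_space E)"

text \<open>The quenched probability of an event, i.e. its conditional probability given the whole
  environment. It is determined only up to null sets.\<close>

definition quenched_prob ::
    "'a measure \<Rightarrow> 'e measure \<Rightarrow> (nat \<Rightarrow> 'a \<Rightarrow> 'e) \<Rightarrow> 'a set \<Rightarrow> 'a \<Rightarrow> real" where
  "quenched_prob M E \<xi> A = real_cond_exp M (env_algebra M E \<xi>) (indicator A)"

definition mean_offspring :: "nat pmf \<Rightarrow> real" where
  "mean_offspring q = (\<Sum>i. real i * pmf q i)"

text \<open>Individuals are numbered from 1; the variables \<open>X n 0\<close> play no role.\<close>

locale branching_process_random_env = prob_space M
  for M :: "'a measure" +
  fixes E :: "'e measure"
    and \<xi> :: "nat \<Rightarrow> 'a \<Rightarrow> 'e"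
    and p :: "'e \<Rightarrow> nat pmf"
    and X :: "nat \<Rightarrow> nat \<Rightarrow> 'a \<Rightarrow> nat"
  assumes env_measurable: "\<And>n. \<xi> n \<in> measurable M E"
    and env_stationary: "stationary M E \<xi>"
    and env_ergodic: "ergodic M E \<xi>"
    and offspring_law_measurable: "\<And>k. (\<lambda>e. pmf (p e) k) \<in> borel_measurable E"
    and mean_finite: "\<And>e. e \<in> space E \<Longrightarrow> summable (\<lambda>i. real i * pmf (p e) i)"
    and mean_positive: "\<And>e. e \<in> space E \<Longrightarrow> mean_offspring (p e) > 0"
    and offspring_measurable: "\<And>n i. i \<ge> 1 \<Longrightarrow> X n i \<in> measurable M (count_space UNIV)"
    and offspring_law: "\<And>n i k. i \<ge> 1 \<Longrightarrow>
          AE \<omega> in M. quenched_prob M E \<xi> {\<omega>'\<in>space M. X n i \<omega>' = k} \<omega> = pmf (p (\<xi> n \<omega>)) k"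
    and offspring_cond_indep: "\<And>J A. finite J \<Longrightarrow> J \<subseteq> UNIV \<times> {1..} \<Longrightarrow>
          AE \<omega> in M. quenched_prob M E \<xi> {\<omega>'\<in>space M. \<forall>(n, i)\<in>J. X n i \<omega>' \<in> A n i} \<omega> =
            (\<Prod>(n, i)\<in>J. quenched_prob M E \<xi> {\<omega>'\<in>space M. X n i \<omega>' \<in> A n i} \<omega>)"

primrec bp_Z :: "(nat \<Rightarrow> nat \<Rightarrow> 'a \<Rightarrow> nat) \<Rightarrow> nat \<Rightarrow> 'a \<Rightarrow> nat" where
  "bp_Z X 0 \<omega> = 1"
| "bp_Z X (Suc n) \<omega> = (\<Sum>i=1..bp_Z X n \<omega>. X n i \<omega>)"

definition env_mean :: "(nat \<Rightarrow> 'a \<Rightarrow> 'e) \<Rightarrow> ('e \<Rightarrow> nat pmf) \<Rightarrow> nat \<Rightarrow> 'a \<Rightarrow> real" where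
  "env_mean \<xi> p n \<omega> = mean_offspring (p (\<xi> n \<omega>))"

definition bp_Pi :: "(nat \<Rightarrow> 'a \<Rightarrow> 'e) \<Rightarrow> ('e \<Rightarrow> nat pmf) \<Rightarrow> nat \<Rightarrow> 'a \<Rightarrow> real" where
  "bp_Pi \<xi> p n \<omega> = (\<Prod>i<n. env_mean \<xi> p i \<omega>)"

definition bp_W ::
    "(nat \<Rightarrow> 'a \<Rightarrow> 'e) \<Rightarrow> ('e \<Rightarrow> nat pmf) \<Rightarrow> (nat \<Rightarrow> nat \<Rightarrow> 'a \<Rightarrow> nat) \<Rightarrow> nat \<Rightarrow> 'a \<Rightarrow> real" where
  "bp_W \<xi> p X n \<omega> = real (bp_Z X n \<omega>) / bp_Pi \<xi> p n \<omega>"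

text \<open>A real supremum: meaningful when the function is essentially bounded below and not almost
  everywhere arbitrarily large.\<close>

definition essinf :: "'a measure \<Rightarrow> ('a \<Rightarrow> real) \<Rightarrow> real" where
  "essinf M f = Sup {c. AE x in M. c \<le> f x}"

definition has_exp_moment :: "'a measure \<Rightarrow> ('a \<Rightarrow> real) \<Rightarrow> real \<Rightarrow> bool" where
  "has_exp_moment M Y \<theta> \<longleftrightarrow> (\<integral>\<^sup>+ \<omega>. ennreal (exp (\<theta> * Y \<omega>)) \<partial>M) < \<infinity>"

end

theory Submission
  imports Defs
begin

text \<open>
  Restricted to an event of the environment on which \<open>\<xi> 0, \<dots>, \<xi> (N - 1)\<close> are frozen, the offspring
  variables of the first \<open>N\<close> generations are independent, so the joint transform of \<open>Z n\<close> and
  \<open>Z N\<close> is given by composed generating functions. Write \<open>m\<close> for the mean of an offspring law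
  with finite exponential moments. Its transform satisfies \<open>E exp (t X / m) \<le> exp (t + A t\<^sup>2)\<close> for
  small \<open>t\<close>, with constants uniform over the finitely many states, and because all means exceed
  some \<open>\<mu> > 1\<close> this form is stable under composition with \<open>A\<close> replaced by
  \<open>D = 4 A / (1 - 1 / \<mu>)\<close>. This bounds the exponential moments of all \<open>W\<^sub>N\<close> and gives
  \<open>E (exp (t \<Pi>\<^sub>n (W\<^sub>N - W\<^sub>n)) | Z\<^sub>n) \<le> exp (D t\<^sup>2 Z\<^sub>n)\<close>. Splitting at \<open>W\<^sub>n \<le> Y\<close> with
  \<open>Y = \<Pi>\<^sub>n\<^bsup>1/3\<^esup> \<epsilon>\<^bsup>2/3\<^esup>\<close>, choosing \<open>t\<close> proportional to \<open>\<Pi>\<^sub>n\<^bsup>-2/3\<^esup> \<epsilon>\<^bsup>-1/3\<^esup>\<close> and letting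
  \<open>N\<close> tend to infinity yields the tail bounds.

  Conversely, the environments whose limiting Laplace transform is identically 1 form a strictly
  shift-invariant set, which is null by ergodicity unless \<open>W = 0\<close> almost surely. Outside it,
  the transform of \<open>W\<close> given \<open>Z\<^sub>1 = k\<close> is at most \<open>a\<^sup>k\<close> with \<open>a < 1\<close>, and Jensen's inequality turns an
  exponential moment of \<open>W\<close> into one of \<open>Z\<^sub>1\<close>.
\<close>

section \<open>Generating functions of the population sizes\<close>

text \<open>Valued in \<open>ennreal\<close>: arguments above 1 carry the exponential moments, and
  the value infinity records their absence without summability side conditions. At
  \<open>exp (- t)\<close> the same function is a Laplace transform.\<close>

definition pgf :: "nat pmf \<Rightarrow> ennreal \<Rightarrow> ennreal" where
  "pgf q s = (\<integral>\<^sup>+k. s ^ k \<partial>measure_pmf q)"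

text \<open>Transform of the population at time \<open>k + n\<close> descending from one individual
  of generation \<open>k\<close>. The oldest generation is the outermost factor, so induction on
  \<open>n\<close> follows the first reproduction of the ancestor.\<close>

primrec pgf_comp :: "(nat \<Rightarrow> nat pmf) \<Rightarrow> nat \<Rightarrow> nat \<Rightarrow> ennreal \<Rightarrow> ennreal" where
  "pgf_comp q k 0 s = s"
| "pgf_comp q k (Suc n) s = pgf (q k) (pgf_comp q (Suc k) n s)"

text \<open>The order in which \<open>pgf_generations\<close> integrates generations out; it also
  shows below that the Laplace transforms are monotone in the generation.\<close>

lemma pgf_comp_Suc_last:
  "pgf_comp q k (Suc n) s = pgf_comp q k n (pgf (q (k + n)) s)"
  by (induction n arbitrary: k) auto

lemma pgf_mono: "s \<le> t \<Longrightarrow> pgf q s \<le> pgf q t"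
  unfolding pgf_def by (intro nn_integral_mono power_mono) auto

lemma pgf_comp_mono: "s \<le> t \<Longrightarrow> pgf_comp q k n s \<le> pgf_comp q k n t"
  by (induction n arbitrary: k) (auto intro: pgf_mono)

lemma bp_Z_measurable:
  assumes "\<And>j i. j < n \<Longrightarrow> i \<ge> 1 \<Longrightarrow> X j i \<in> measurable M (count_space UNIV)"
  shows "bp_Z X n \<in> measurable M (count_space UNIV)"
  using assms
proof (induction n)
  case 0
  have "bp_Z X 0 = (\<lambda>_. 1)" by (auto simp: fun_eq_iff)
  then show ?case by simp
next
  case (Suc n)
  have [measurable]: "bp_Z X n \<in> measurable M (count_space UNIV)"
    using Suc by simp
  have 1: "(\<lambda>\<omega>. \<Sum>i=1..a. X n i \<omega>) \<in> measurable M (count_space UNIV)" for a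
  proof (induction a)
    case (Suc a)
    have [measurable]: "X n (Suc a) \<in> measurable M (count_space UNIV)"
      using Suc.prems \<open>\<And>j i. j < Suc n \<Longrightarrow> i \<ge> 1 \<Longrightarrow> _\<close> by simp
    note [measurable] = Suc.IH
    have "(\<lambda>\<omega>. (\<Sum>i=1..a. X n i \<omega>) + X n (Suc a) \<omega>) \<in> measurable M (count_space UNIV)"
      by measurable
    then show ?case by simp
  qed simp
  have "(\<lambda>\<omega>. (\<lambda>a \<omega>. \<Sum>i=1..a. X n i \<omega>) (bp_Z X n \<omega>) \<omega>) \<in> measurable M (count_space UNIV)"
    by (rule measurable_compose_countable[OF 1]) simp
  then show ?case by (simp cong: measurable_cong)
qed

lemma bp_Z_cong:
  assumes "\<And>j i. j < n \<Longrightarrow> i \<ge> 1 \<Longrightarrow> X j i \<omega> = Y j i \<omega>'"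
  shows "bp_Z X n \<omega> = bp_Z Y n \<omega>'"
  using assms by (induction n) auto

text \<open>Given \<open>bp_Z X k = a\<close>, the next generation is a sum of \<open>a\<close>
  independent variables that are also independent of the earlier generations, so its transform is an
  \<open>a\<close>-th power. The weight \<open>\<phi>\<close> of an earlier size passes through
  untouched, which later allows tilting by a function of \<open>Z n\<close>. Only generations below
  \<open>N\<close> are constrained because the lemma is applied with finitely many frozen
  environment values.\<close>

lemma (in prob_space) pgf_one_generation:
  fixes X :: "nat \<Rightarrow> nat \<Rightarrow> 'a \<Rightarrow> nat" and \<phi> :: "nat \<Rightarrow> ennreal"
  assumes indep: "indep_vars (\<lambda>_. count_space UNIV) (\<lambda>(n, i). X n i) ({..<N} \<times> {1..})"
    and law: "\<And>n i. n < N \<Longrightarrow> i \<ge> 1 \<Longrightarrow> distr M (count_space UNIV) (X n i) = measure_pmf (q n)"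
    and "n \<le> k" "k < N"
  shows "(\<integral>\<^sup>+\<omega>. \<phi> (bp_Z X n \<omega>) * s ^ bp_Z X (Suc k) \<omega> \<partial>M)
       = (\<integral>\<^sup>+\<omega>. \<phi> (bp_Z X n \<omega>) * pgf (q k) s ^ bp_Z X k \<omega> \<partial>M)"
proof -
  have Xm [measurable]: "X j i \<in> measurable M (count_space UNIV)" if "j < N" "i \<ge> 1" for j i
    using indep that unfolding indep_vars_def by (auto simp del: One_nat_def)
  have Zm [measurable]: "bp_Z X j \<in> measurable M (count_space UNIV)" if "j \<le> N" for j
    using that by (intro bp_Z_measurable Xm) auto
  note [measurable] = Zm[of n] Zm[of k] Zm[of "Suc k"]
  have [simp]: "n \<le> N" "k \<le> N" "Suc k \<le> N" using assms by auto
  \<comment> \<open>Restricts to the event \<open>bp_Z X k = a\<close>, so that the random number of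
    summands becomes the constant \<open>a\<close>; \<open>split\<close> sums over \<open>a\<close>
    again.\<close>
  define H where "H a z z' = (if z' = a then \<phi> z else 0)" for a z z' :: nat
  have step: "(\<integral>\<^sup>+\<omega>. H a (bp_Z X n \<omega>) (bp_Z X k \<omega>) * (\<Prod>i=1..a. s ^ X k i \<omega>) \<partial>M)
       = (\<integral>\<^sup>+\<omega>. H a (bp_Z X n \<omega>) (bp_Z X k \<omega>) \<partial>M) * pgf (q k) s ^ a" for a
  proof -
    \<comment> \<open>The variables fall into \<open>a + 1\<close> blocks: block 0 collects the
      generations before \<open>k\<close>, which determine both population sizes in
      \<open>H\<close>, and block \<open>j \<ge> 1\<close> is the single variable
      \<open>X k j\<close>.\<close>
    define K where "K j = (if j = 0 then {..<k} \<times> {1..} else {(k, j)})" for j :: nat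
    \<comment> \<open>Coordinate process on the product space: \<open>bp_Z V\<close> expresses the
      population sizes as functions of block 0 alone.\<close>
    define V where "V = (\<lambda>(j::nat) (i::nat) (w::nat \<times> nat \<Rightarrow> nat). w (j, i))"
    define Y where "Y j w = (if j = 0 then H a (bp_Z V n w) (bp_Z V k w) else s ^ (w (k, j)))"
      for j :: nat and w :: "nat \<times> nat \<Rightarrow> nat"
    have i1: "indep_vars (\<lambda>j. PiM (K j) (\<lambda>_. count_space UNIV))
        (\<lambda>j \<omega>. restrict (\<lambda>i. (case i of (n, i) \<Rightarrow> X n i) \<omega>) (K j)) {0..a}"
      using \<open>k < N\<close> by (intro indep_vars_restrict[OF indep])
        (auto simp: K_def disjoint_family_on_def split: if_splits)
    have i2: "indep_vars (\<lambda>_. borel)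
        (\<lambda>j \<omega>. Y j (restrict (\<lambda>i. (case i of (n, i) \<Rightarrow> X n i) \<omega>) (K j))) {0..a}"
    proof (rule indep_vars_compose2[OF i1])
      fix j assume "j \<in> {0..a}"
      show "Y j \<in> borel_measurable (PiM (K j) (\<lambda>_. count_space UNIV))"
      proof (cases "j = 0")
        case True
        have Vm: "V j' i \<in> measurable (PiM (K j) (\<lambda>_. count_space UNIV)) (count_space UNIV)"
          if "j' < k" "i \<ge> 1" for j' i
          unfolding V_def using that by (intro measurable_component_singleton) (auto simp: K_def True)
        have [measurable]: "bp_Z V n \<in> measurable (PiM (K j) (\<lambda>_. count_space UNIV)) (count_space UNIV)"
           "bp_Z V k \<in> measurable (PiM (K j) (\<lambda>_. count_space UNIV)) (count_space UNIV)"
          using \<open>n \<le> k\<close> by (auto intro!: bp_Z_measurable Vm)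
        have "Y j = (\<lambda>w. H a (bp_Z V n w) (bp_Z V k w))" by (simp add: Y_def True fun_eq_iff)
        then show ?thesis unfolding H_def by simp measurable
      next
        case False
        have [measurable]: "(\<lambda>w. w (k, j)) \<in> measurable (PiM (K j) (\<lambda>_. count_space UNIV)) (count_space UNIV)"
          by (intro measurable_component_singleton) (auto simp: K_def False)
        have "Y j = (\<lambda>w. s ^ w (k, j))" by (simp add: Y_def False fun_eq_iff)
        then show ?thesis by simp
      qed
    qed
    let ?R = "\<lambda>j \<omega>. Y j (restrict (\<lambda>i. (case i of (n, i) \<Rightarrow> X n i) \<omega>) (K j))"
    have R0: "?R 0 \<omega> = H a (bp_Z X n \<omega>) (bp_Z X k \<omega>)" for \<omega>
    proof -
      have "bp_Z V j (restrict (\<lambda>i. (case i of (n, i) \<Rightarrow> X n i) \<omega>) (K 0)) = bp_Z X j \<omega>" if "j \<le> k" for j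
        using that by (intro bp_Z_cong) (auto simp: V_def K_def)
      then show ?thesis using \<open>n \<le> k\<close> by (simp add: Y_def)
    qed
    have Rj: "?R j \<omega> = s ^ X k j \<omega>" if "j \<ge> 1" for j \<omega>
      using that by (simp add: Y_def K_def)
    have "(\<integral>\<^sup>+\<omega>. (\<Prod>j\<in>{0..a}. ?R j \<omega>) \<partial>M) = (\<Prod>j\<in>{0..a}. \<integral>\<^sup>+\<omega>. ?R j \<omega> \<partial>M)"
      by (rule indep_vars_nn_integral[OF _ i2]) auto
    moreover have "(\<Prod>j\<in>{0..a}. ?R j \<omega>) = H a (bp_Z X n \<omega>) (bp_Z X k \<omega>) * (\<Prod>i=1..a. s ^ X k i \<omega>)" for \<omega>
      by (subst prod.atLeast_Suc_atMost) (auto simp: R0 Rj simp del: power_Suc intro!: arg_cong2[where f="(*)"] prod.cong)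
    moreover have "(\<integral>\<^sup>+\<omega>. s ^ X k j \<omega> \<partial>M) = pgf (q k) s" if "j \<ge> 1" for j
    proof -
      have "pgf (q k) s = (\<integral>\<^sup>+l. s ^ l \<partial>distr M (count_space UNIV) (X k j))"
        using law[OF \<open>k < N\<close> that] by (simp add: pgf_def)
      also have "\<dots> = (\<integral>\<^sup>+\<omega>. s ^ X k j \<omega> \<partial>M)"
        using that \<open>k < N\<close> by (subst nn_integral_distr) auto
      finally show ?thesis ..
    qed
    then have "(\<Prod>j\<in>{0..a}. \<integral>\<^sup>+\<omega>. ?R j \<omega> \<partial>M)
      = (\<integral>\<^sup>+\<omega>. H a (bp_Z X n \<omega>) (bp_Z X k \<omega>) \<partial>M) * pgf (q k) s ^ a"
      by (subst prod.atLeast_Suc_atMost) (auto simp: R0 Rj)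
    ultimately show ?thesis by simp
  qed
  have split: "\<phi> z * f z' = (\<Sum>a. H a z z' * f a)" for f :: "nat \<Rightarrow> ennreal" and z z'
  proof -
    have "(\<Sum>a. H a z z' * f a) = (\<Sum>a\<in>{z'}. H a z z' * f a)"
      by (rule suminf_finite) (auto simp: H_def)
    then show ?thesis by (simp add: H_def)
  qed
  have "(\<integral>\<^sup>+\<omega>. \<phi> (bp_Z X n \<omega>) * s ^ bp_Z X (Suc k) \<omega> \<partial>M)
     = (\<integral>\<^sup>+\<omega>. \<phi> (bp_Z X n \<omega>) * (\<Prod>i=1..bp_Z X k \<omega>. s ^ X k i \<omega>) \<partial>M)"
    by (simp add: power_sum)
  also have "\<dots> = (\<integral>\<^sup>+\<omega>. (\<Sum>a. H a (bp_Z X n \<omega>) (bp_Z X k \<omega>) * (\<Prod>i=1..a. s ^ X k i \<omega>)) \<partial>M)"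
    by (subst split) rule
  also have "\<dots> = (\<Sum>a. \<integral>\<^sup>+\<omega>. H a (bp_Z X n \<omega>) (bp_Z X k \<omega>) * (\<Prod>i=1..a. s ^ X k i \<omega>) \<partial>M)"
  proof (rule nn_integral_suminf)
    fix a
    have [measurable]: "(\<lambda>\<omega>. s ^ X k i \<omega>) \<in> borel_measurable M" if "i \<in> {1..a}" for i
      using that Xm[OF \<open>k < N\<close>, of i] by simp
    show "(\<lambda>\<omega>. H a (bp_Z X n \<omega>) (bp_Z X k \<omega>) * (\<Prod>i=1..a. s ^ X k i \<omega>)) \<in> borel_measurable M"
      unfolding H_def by measurable
  qed
  also have "\<dots> = (\<Sum>a. (\<integral>\<^sup>+\<omega>. H a (bp_Z X n \<omega>) (bp_Z X k \<omega>) * pgf (q k) s ^ a \<partial>M))"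
    unfolding step by (subst nn_integral_multc) (auto simp: H_def)
  also have "\<dots> = (\<integral>\<^sup>+\<omega>. (\<Sum>a. H a (bp_Z X n \<omega>) (bp_Z X k \<omega>) * pgf (q k) s ^ a) \<partial>M)"
    by (rule nn_integral_suminf[symmetric]) (auto simp: H_def)
  also have "\<dots> = (\<integral>\<^sup>+\<omega>. \<phi> (bp_Z X n \<omega>) * pgf (q k) s ^ bp_Z X k \<omega> \<partial>M)"
    by (simp only: split[of _ "\<lambda>a. pgf (q k) s ^ a"])
  finally show ?thesis .
qed

text \<open>Generations are integrated out from the last one down to \<open>n\<close>, each
  replacing the argument by a generating function of it.\<close>

lemma (in prob_space) pgf_generations:
  fixes X :: "nat \<Rightarrow> nat \<Rightarrow> 'a \<Rightarrow> nat" and \<phi> :: "nat \<Rightarrow> ennreal"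
  assumes "indep_vars (\<lambda>_. count_space UNIV) (\<lambda>(n, i). X n i) ({..<N} \<times> {1..})"
    and "\<And>n i. n < N \<Longrightarrow> i \<ge> 1 \<Longrightarrow> distr M (count_space UNIV) (X n i) = measure_pmf (q n)"
    and "n + l \<le> N"
  shows "(\<integral>\<^sup>+\<omega>. \<phi> (bp_Z X n \<omega>) * s ^ bp_Z X (n + l) \<omega> \<partial>M)
       = (\<integral>\<^sup>+\<omega>. \<phi> (bp_Z X n \<omega>) * pgf_comp q n l s ^ bp_Z X n \<omega> \<partial>M)"
  using assms(3)
proof (induction l arbitrary: s)
  case (Suc l)
  have "(\<integral>\<^sup>+\<omega>. \<phi> (bp_Z X n \<omega>) * s ^ bp_Z X (n + Suc l) \<omega> \<partial>M)
      = (\<integral>\<^sup>+\<omega>. \<phi> (bp_Z X n \<omega>) * pgf (q (n + l)) s ^ bp_Z X (n + l) \<omega> \<partial>M)"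
    using pgf_one_generation[OF assms(1,2), of n "n + l" \<phi> s] Suc.prems by simp
  also have "\<dots> = (\<integral>\<^sup>+\<omega>. \<phi> (bp_Z X n \<omega>) * pgf_comp q n l (pgf (q (n + l)) s) ^ bp_Z X n \<omega> \<partial>M)"
    using Suc by simp
  finally show ?case by (simp only: pgf_comp_Suc_last)
qed simp

section \<open>Exponential bounds for generating functions\<close>

lemma mean_offspring_integral:
  assumes "summable (\<lambda>i. real i * pmf q i)"
  shows "integrable (measure_pmf q) real" "mean_offspring q = (\<integral>k. real k \<partial>measure_pmf q)"
proof -
  have 1: "integrable (count_space UNIV) (\<lambda>i. pmf q i * real i)"
    using assms by (simp add: integrable_count_space_nat_iff mult.commute)
  then show "integrable (measure_pmf q) real"
    by (simp add: measure_pmf_eq_density integrable_density)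
  have "(\<integral>k. real k \<partial>measure_pmf q) = (\<integral>i. pmf q i * real i \<partial>count_space UNIV)"
    by (simp add: measure_pmf_eq_density integral_density)
  also have "\<dots> = mean_offspring q"
    using integral_count_space_nat[OF 1] by (simp add: mean_offspring_def mult.commute)
  finally show "mean_offspring q = (\<integral>k. real k \<partial>measure_pmf q)" ..
qed

text \<open>Some value \<open>k \<ge> 2\<close> is charged and 0 is not, so the offspring number
  minus 1 dominates the indicator of \<open>{k}\<close> and has positive expectation.\<close>

lemma mean_offspring_gt_1:
  assumes "summable (\<lambda>i. real i * pmf q i)" "pmf q 0 = 0" "pmf q 1 < 1"
  shows "mean_offspring q > 1"
proof -
  have "\<exists>k\<ge>2. pmf q k > 0"
  proof (rule ccontr)
    assume "\<not> (\<exists>k\<ge>2. pmf q k > 0)"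
    then have "pmf q k = 0" if "k \<ge> 2" for k
      using that pmf_nonneg[of q k] by (auto simp: less_le)
    then have "pmf q k = 0" if "k \<noteq> 1" for k
      using that assms(2) by (cases "k = 0"; cases "k = 1") auto
    then have "set_pmf q \<subseteq> {1}" unfolding set_pmf_iff subset_iff by blast
    then have "measure_pmf.prob q {1} = 1"
      by (subst measure_pmf.prob_eq_1) (auto simp: AE_measure_pmf_iff)
    then show False using assms(3) by (simp add: measure_pmf_single)
  qed
  then obtain k where k: "k \<ge> 2" "pmf q k > 0" by auto
  note I = mean_offspring_integral[OF assms(1)]
  have pos: "j \<ge> 1" if "j \<in> set_pmf q" for j
    using that assms(2) by (cases j) (auto simp: set_pmf_iff)
  have "mean_offspring q - 1 = (\<integral>j. real j - 1 \<partial>measure_pmf q)"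
    using I by simp
  moreover have "pmf q k = (\<integral>j. indicator {k} j \<partial>measure_pmf q)"
    by (simp add: measure_pmf_single)
  moreover have "(\<integral>j. indicator {k} j \<partial>measure_pmf q) \<le> (\<integral>j. real j - 1 \<partial>measure_pmf q)"
  proof (rule integral_mono_AE)
    show "integrable (measure_pmf q) (indicator {k} :: nat \<Rightarrow> real)"
      by (rule measure_pmf.integrable_const_bound[where B = 1]) auto
    show "AE j in measure_pmf q. indicator {k} j \<le> real j - 1"
      using k pos by (auto simp: AE_measure_pmf_iff indicator_def)
  qed (use I in simp)
  ultimately show ?thesis using k by linarith
qed

text \<open>Second-order Taylor expansion with Lagrange remainder; the absolute value in the
  exponent makes the bound usable for both signs of \<open>z\<close>.\<close>

lemma exp_le_quadratic:
  fixes z :: real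
  shows "exp z \<le> 1 + z + z\<^sup>2 * exp \<bar>z\<bar>"
proof -
  obtain t where t: "\<bar>t\<bar> \<le> \<bar>z\<bar>" "exp z = (\<Sum>m<2. z ^ m / fact m) + exp t / fact 2 * z ^ 2"
    using Maclaurin_exp_le[of z 2] by auto
  have "exp t / 2 * z\<^sup>2 \<le> exp \<bar>z\<bar> * z\<^sup>2"
  proof (rule mult_right_mono)
    have "exp t \<le> exp \<bar>z\<bar>" using t by auto
    then show "exp t / 2 \<le> exp \<bar>z\<bar>" using exp_gt_zero[of t] by linarith
  qed simp
  then show ?thesis using t by (simp add: numeral_2_eq_2 mult.commute)
qed

text \<open>After division by the mean the first-order term of the transform is exactly
  \<open>t\<close>, and the remainder is quadratic because the exponential moment bounds the
  expectation of \<open>k^2 exp (|u| k)\<close>. Both signs of \<open>t\<close> are covered, as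
  upward and downward deviations are estimated later.\<close>

lemma pgf_exp_bound:
  assumes "summable (\<lambda>i. real i * pmf q i)" and m: "mean_offspring q > 0"
    and "\<theta> > 0" and fin: "pgf q (ennreal (exp \<theta>)) < \<infinity>"
  shows "\<exists>A\<ge>0. \<exists>\<tau>>0. \<forall>t. \<bar>t\<bar> \<le> \<tau> \<longrightarrow>
    pgf q (ennreal (exp (t / mean_offspring q))) \<le> ennreal (exp (t + A * t\<^sup>2))"
proof -
  let ?m = "mean_offspring q"
  define I where "I = (\<integral>k. exp (\<theta> * real k) \<partial>measure_pmf q)"
  define A where "A = 8 * I / (\<theta>\<^sup>2 * ?m\<^sup>2)"
  note mean = mean_offspring_integral[OF assms(1)]
  have pgf_exp: "pgf q (ennreal (exp u)) = (\<integral>\<^sup>+k. ennreal (exp (u * real k)) \<partial>measure_pmf q)" for u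
    unfolding pgf_def by (intro nn_integral_cong) (simp add: ennreal_power exp_of_nat_mult[symmetric] mult.commute)
  have int: "integrable (measure_pmf q) (\<lambda>k. exp (\<theta> * real k))"
    using fin unfolding pgf_exp by (intro integrableI_bounded) auto
  have "I \<ge> 0" unfolding I_def by simp
  then have "A \<ge> 0" unfolding A_def by simp
  moreover have "\<theta> * ?m / 2 > 0" using assms by simp
  moreover have "pgf q (ennreal (exp (t / ?m))) \<le> ennreal (exp (t + A * t\<^sup>2))"
    if t: "\<bar>t\<bar> \<le> \<theta> * ?m / 2" for t
  proof -
    define u where "u = t / ?m"
    have u: "\<bar>u\<bar> \<le> \<theta> / 2"
      using t m by (simp add: u_def abs_divide field_simps)
    have bound: "exp (u * real k) \<le> 1 + u * real k + u\<^sup>2 * (8 / \<theta>\<^sup>2) * exp (\<theta> * real k)" for k :: nat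
    proof -
      \<comment> \<open>Half of the exponent \<open>\<theta>\<close> absorbs the factor
        \<open>k^2\<close>, where 8 comes from \<open>x^2 / 2 \<le> exp x\<close> at
        \<open>x = \<theta> k / 2\<close>; the other half absorbs \<open>exp |u k|\<close>.\<close>
      have "(\<theta> * real k / 2)\<^sup>2 / 2 \<le> exp (\<theta> * real k / 2)"
        using exp_lower_Taylor_quadratic[of "\<theta> * real k / 2"] \<open>\<theta> > 0\<close>
          mult_nonneg_nonneg[of \<theta> "real k"] by linarith
      then have "(real k)\<^sup>2 \<le> 8 / \<theta>\<^sup>2 * exp (\<theta> * real k / 2)"
        using \<open>\<theta> > 0\<close> by (simp add: field_simps power2_eq_square)
      moreover have "exp \<bar>u * real k\<bar> \<le> exp (\<theta> * real k / 2)"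
        using mult_right_mono[OF u, of "real k"] by (simp add: abs_mult)
      ultimately have "(real k)\<^sup>2 * exp \<bar>u * real k\<bar>
          \<le> 8 / \<theta>\<^sup>2 * exp (\<theta> * real k / 2) * exp (\<theta> * real k / 2)"
        by (intro mult_mono) auto
      also have "\<dots> = 8 / \<theta>\<^sup>2 * exp (\<theta> * real k)"
        by (simp add: exp_add[symmetric])
      finally have "u\<^sup>2 * ((real k)\<^sup>2 * exp \<bar>u * real k\<bar>) \<le> u\<^sup>2 * (8 / \<theta>\<^sup>2 * exp (\<theta> * real k))"
        by (rule mult_left_mono) simp
      then show ?thesis
        using exp_le_quadratic[of "u * real k"] by (simp add: power_mult_distrib mult.assoc)
    qed
    have int': "integrable (measure_pmf q) (\<lambda>k. 1 + u * real k + u\<^sup>2 * (8 / \<theta>\<^sup>2) * exp (\<theta> * real k))"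
      using int mean(1) by (intro Bochner_Integration.integrable_add integrable_mult_right) auto
    have "pgf q (ennreal (exp (t / ?m)))
        \<le> (\<integral>\<^sup>+k. ennreal (1 + u * real k + u\<^sup>2 * (8 / \<theta>\<^sup>2) * exp (\<theta> * real k)) \<partial>measure_pmf q)"
      unfolding pgf_exp u_def[symmetric] by (intro nn_integral_mono ennreal_leI bound)
    also have "\<dots> = ennreal (\<integral>k. 1 + u * real k + u\<^sup>2 * (8 / \<theta>\<^sup>2) * exp (\<theta> * real k) \<partial>measure_pmf q)"
      by (rule nn_integral_eq_integral[OF int'])
        (intro AE_I2 order_trans[OF _ bound], simp)
    also have "(\<integral>k. 1 + u * real k + u\<^sup>2 * (8 / \<theta>\<^sup>2) * exp (\<theta> * real k) \<partial>measure_pmf q)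
        = 1 + u * ?m + u\<^sup>2 * (8 / \<theta>\<^sup>2) * I"
      using int mean by (simp add: I_def)
    also have "\<dots> = 1 + (t + A * t\<^sup>2)"
      using m by (simp add: u_def A_def power_divide mult_ac)
    also have "ennreal \<dots> \<le> ennreal (exp (t + A * t\<^sup>2))"
      by (intro ennreal_leI exp_ge_add_one_self)
    finally show ?thesis .
  qed
  ultimately show ?thesis by blast
qed

text \<open>The form \<open>exp (t + D t^2)\<close> survives one more generation: the inner bound at
  \<open>t / m\<close> is read as an argument \<open>u / m\<close> of the outer transform with
  \<open>u = t + D t^2 / m\<close>, and the outer bound adds \<open>A u^2 \<le> 4 A t^2\<close>. As
  \<open>m \<ge> \<mu>\<close>, the quadratic part shrinks by the factor \<open>1 / \<mu>\<close>,
  and \<open>D\<close> solves \<open>D / \<mu> + 4 A = D\<close>. The condition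
  \<open>D * c \<le> 1\<close> yields \<open>|u| \<le> 2 |t|\<close>, and
  \<open>2 * c \<le> \<tau>\<close> keeps \<open>u\<close> in the range of the one-step
  bound.\<close>

lemma pgf_comp_exp_bound:
  fixes q :: "nat \<Rightarrow> nat pmf"
  assumes "\<mu> > 1" "A \<ge> 0" and D: "D = 4 * A / (1 - 1 / \<mu>)"
    and c: "2 * c \<le> \<tau>" "D * c \<le> 1"
    and mean: "\<And>j. j \<in> {k..<k + n} \<Longrightarrow> mean_offspring (q j) \<ge> \<mu>"
    and bound: "\<And>j t. j \<in> {k..<k + n} \<Longrightarrow> \<bar>t\<bar> \<le> \<tau> \<Longrightarrow>
      pgf (q j) (ennreal (exp (t / mean_offspring (q j)))) \<le> ennreal (exp (t + A * t\<^sup>2))"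
    and t: "\<bar>t\<bar> \<le> c"
  shows "pgf_comp q k n (ennreal (exp (t / (\<Prod>j=k..<k + n. mean_offspring (q j)))))
    \<le> ennreal (exp (t + D * t\<^sup>2))"
  using mean bound t
proof (induction n arbitrary: k t)
  case 0
  have "D \<ge> 0" using assms(1,2) by (simp add: D)
  then show ?case by simp
next
  case (Suc n)
  let ?m = "mean_offspring (q k)"
  have "D \<ge> 0" using assms(1,2) by (simp add: D)
  have m: "?m \<ge> \<mu>" using Suc.prems by simp
  then have m1: "?m > 1" using assms by simp
  define t' where "t' = t / ?m"
  have t': "\<bar>t'\<bar> \<le> \<bar>t\<bar>"
    using m1 mult_left_mono[of 1 ?m "\<bar>t\<bar>"] by (simp add: t'_def abs_divide field_simps)
  have prod: "(\<Prod>j=k..<k + Suc n. mean_offspring (q j)) = ?m * (\<Prod>j=Suc k..<Suc k + n. mean_offspring (q j))"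
    by (subst prod.atLeast_Suc_lessThan) auto
  have IH: "pgf_comp q (Suc k) n (ennreal (exp (t' / (\<Prod>j=Suc k..<Suc k + n. mean_offspring (q j)))))
    \<le> ennreal (exp (t' + D * t'\<^sup>2))"
    using Suc.prems t' by (intro Suc.IH) auto
  define u where "u = t + D * t\<^sup>2 / ?m"
  have u_eq: "t' + D * t'\<^sup>2 = u / ?m"
    using m1 by (simp add: u_def t'_def power_divide add_divide_distrib power2_eq_square)
  have "D * \<bar>t\<bar> \<le> 1"
    using \<open>D \<ge> 0\<close> Suc.prems(3) c by (meson mult_left_mono order_trans)
  then have Dt2: "D * t\<^sup>2 \<le> \<bar>t\<bar>"
    using mult_right_mono[of "D * \<bar>t\<bar>" 1 "\<bar>t\<bar>"] by (simp add: power2_eq_square mult.assoc)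
  have "D * t\<^sup>2 / ?m \<le> D * t\<^sup>2 / 1"
    using m1 \<open>D \<ge> 0\<close> by (intro divide_left_mono) auto
  moreover have "D * t\<^sup>2 / ?m \<ge> 0" using m1 \<open>D \<ge> 0\<close> by simp
  ultimately have u: "\<bar>u\<bar> \<le> 2 * \<bar>t\<bar>" using Dt2 unfolding u_def by linarith
  then have "\<bar>u\<bar>\<^sup>2 \<le> (2 * \<bar>t\<bar>)\<^sup>2" by (intro power_mono) auto
  then have u2: "A * u\<^sup>2 \<le> 4 * A * t\<^sup>2"
    using mult_left_mono[of "u\<^sup>2" "4 * t\<^sup>2" A] \<open>A \<ge> 0\<close> by (simp add: power_mult_distrib mult_ac)
  have "D * t\<^sup>2 / ?m \<le> D * t\<^sup>2 / \<mu>"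
    using m \<open>\<mu> > 1\<close> \<open>D \<ge> 0\<close> by (intro divide_left_mono) auto
  moreover have "D * (1 - 1 / \<mu>) = 4 * A"
    using \<open>\<mu> > 1\<close> by (simp add: D)
  then have "4 * A = D - D / \<mu>"
    by (simp add: right_diff_distrib)
  then have "4 * A * t\<^sup>2 = D * t\<^sup>2 - D * t\<^sup>2 / \<mu>"
    by (simp add: left_diff_distrib)
  ultimately have final: "u + A * u\<^sup>2 \<le> t + D * t\<^sup>2"
    using u2 unfolding u_def by linarith
  have "pgf_comp q k (Suc n) (ennreal (exp (t / (\<Prod>j=k..<k + Suc n. mean_offspring (q j)))))
     = pgf (q k) (pgf_comp q (Suc k) n (ennreal (exp (t' / (\<Prod>j=Suc k..<Suc k + n. mean_offspring (q j))))))"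
    unfolding prod by (simp add: t'_def)
  also have "\<dots> \<le> pgf (q k) (ennreal (exp (u / ?m)))"
    using IH unfolding u_eq by (rule pgf_mono)
  also have "\<dots> \<le> ennreal (exp (u + A * u\<^sup>2))"
    using u c Suc.prems by (intro Suc.prems(2)) auto
  also have "\<dots> \<le> ennreal (exp (t + D * t\<^sup>2))"
    using final by (intro ennreal_leI) simp
  finally show ?case .
qed

section \<open>Conditioning on a finite piece of the environment\<close>

locale finite_env_branching = branching_process_random_env M E \<xi> p X
  for M :: "'a measure" and E :: "'e measure" and \<xi> p X +
  fixes S :: "'e set"
  assumes finite_S: "finite S" and E_eq: "E = count_space S"
begin

abbreviation "G \<equiv> env_algebra M E \<xi>"
abbreviation "m \<equiv> \<lambda>e. mean_offspring (p e)"
abbreviation "Z \<equiv> bp_Z X"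
abbreviation "\<Pi>w \<equiv> bp_Pi \<xi> p"

text \<open>With finitely many states, the distinct cylinders of a given length are finitely many
  and partition the space, so claims about integrals over environment events can be checked on one
  cylinder at a time.\<close>

definition cyl :: "(nat \<Rightarrow> 'e) \<Rightarrow> nat \<Rightarrow> 'a set" where
  "cyl x N = {\<omega>\<in>space M. \<forall>j<N. \<xi> j \<omega> = x j}"

lemma space_E [simp]: "space E = S"
  by (simp add: E_eq)

lemma env_in_S: "\<omega> \<in> space M \<Longrightarrow> \<xi> n \<omega> \<in> S"
  using measurable_space[OF env_measurable, of \<omega> n] by simp

lemma env_seq_measurable: "env_seq \<xi> \<in> measurable M (env_space E)"
  unfolding env_seq_def env_space_def by (intro measurable_PiM_single') (auto simp: env_measurable env_in_S)

lemma env_seq_measurable_G: "env_seq \<xi> \<in> measurable G (env_space E)"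
  unfolding env_algebra_def
  by (intro measurable_vimage_algebra1) (use measurable_space[OF env_seq_measurable] in auto)

lemma space_G [simp]: "space G = space M"
  by (simp add: env_algebra_def)

lemma sets_G_subset: "sets G \<subseteq> sets M"
  unfolding env_algebra_def
  by (rule sets_image_in_sets[OF refl env_seq_measurable])

lemma sets_G_D [measurable_dest]: "B \<in> sets G \<Longrightarrow> B \<in> sets M"
  using sets_G_subset by auto

lemma env_measurable_G: "\<xi> n \<in> measurable G E"
proof -
  have "(\<lambda>\<omega>. env_seq \<xi> \<omega> n) \<in> measurable G E"
    by (rule measurable_compose[OF env_seq_measurable_G[unfolded env_space_def]])
      (rule measurable_component_singleton, simp)
  then show ?thesis by (simp add: env_seq_def)
qed

lemma env_fun_measurable_G: "(\<lambda>\<omega>. f (\<xi> n \<omega>)) \<in> borel_measurable G"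
  by (rule measurable_compose[OF env_measurable_G]) (simp add: E_eq)

lemma env_fun_measurable: "(\<lambda>\<omega>. f (\<xi> n \<omega>)) \<in> borel_measurable M"
  by (rule measurable_compose[OF env_measurable]) (simp add: E_eq)

lemma env_eq_in_G: "{\<omega>\<in>space M. \<xi> n \<omega> = e} \<in> sets G"
proof -
  have "\<xi> n -` ({e} \<inter> S) \<inter> space G \<in> sets G"
    by (rule measurable_sets[OF env_measurable_G]) (simp add: E_eq)
  moreover have "\<xi> n -` ({e} \<inter> S) \<inter> space G = {\<omega>\<in>space M. \<xi> n \<omega> = e}"
    using env_in_S by auto
  ultimately show ?thesis by simp
qed

lemma cyl_in_G: "cyl x N \<in> sets G"
proof (cases "N = 0")
  case True
  then show ?thesis using sets.top[of G] by (simp add: cyl_def)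
next
  case False
  then have "cyl x N = (\<Inter>j\<in>{..<N}. {\<omega>\<in>space M. \<xi> j \<omega> = x j})"
    by (auto simp: cyl_def)
  also have "\<dots> \<in> sets G"
    using False by (intro sets.finite_INT env_eq_in_G) auto
  finally show ?thesis .
qed

lemma subalgebra_G: "subalgebra M G"
  using sets_G_subset by (simp add: subalgebra_def)

sublocale G: finite_measure_subalgebra M G
  by unfold_locales (rule subalgebra_G)

section \<open>Quenched laws and independence on cylinders\<close>

lemma X_measurable [measurable]: "i \<ge> 1 \<Longrightarrow> X n i \<in> measurable M (count_space UNIV)"
  by (rule offspring_measurable)

lemma Z_measurable [measurable]: "Z n \<in> measurable M (count_space UNIV)"
  by (intro bp_Z_measurable offspring_measurable)

text \<open>The defining property of conditional expectation, applied to an indicator: the quenched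
  probability is handled through its integrals over environment events.\<close>

lemma quenched_integral:
  assumes "A \<in> sets M" "B \<in> sets G"
  shows "measure M (B \<inter> A) = (\<integral>\<omega>\<in>B. quenched_prob M E \<xi> A \<omega> \<partial>M)"
proof -
  have "(\<integral>\<omega>\<in>B. quenched_prob M E \<xi> A \<omega> \<partial>M) = (\<integral>\<omega>\<in>B. indicator A \<omega> \<partial>M)"
    unfolding quenched_prob_def using assms
    by (intro G.real_cond_exp_intA[symmetric]) (auto simp: integrable_real_indicator less_top[symmetric])
  also have "\<dots> = (\<integral>\<omega>. indicator (B \<inter> A) \<omega> \<partial>M)"
    unfolding set_lebesgue_integral_def by (intro Bochner_Integration.integral_cong) (auto simp: indicator_def)
  also have "\<dots> = measure M (B \<inter> A)"
    using assms by simp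
  finally show ?thesis ..
qed

lemma set_integral_AE_const:
  assumes "B \<in> sets M" "AE \<omega> in M. \<omega> \<in> B \<longrightarrow> f \<omega> = (c :: real)" "f \<in> borel_measurable M"
  shows "(\<integral>\<omega>\<in>B. f \<omega> \<partial>M) = measure M B * c"
proof -
  have "(\<integral>\<omega>\<in>B. f \<omega> \<partial>M) = (\<integral>\<omega>. indicator B \<omega> * c \<partial>M)"
    unfolding set_lebesgue_integral_def using assms
    by (intro integral_cong_AE) (auto simp: indicator_def elim!: eventually_mono)
  also have "\<dots> = measure M B * c"
    using assms(1) by simp
  finally show ?thesis .
qed

lemma quenched_prob_measurable: "quenched_prob M E \<xi> A \<in> borel_measurable G"
  unfolding quenched_prob_def by (rule borel_measurable_cond_exp)

lemma quenched_prob_measurable' [measurable]: "quenched_prob M E \<xi> A \<in> borel_measurable M"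
  unfolding quenched_prob_def by (rule borel_measurable_cond_exp2)

text \<open>The quenched law is given by its point masses only; under the measure conditioned on
  \<open>B\<close> these identify the whole distribution of \<open>X n i\<close>, which yields
  arbitrary \<open>A\<close> at once.\<close>

lemma offspring_law_on:
  assumes B: "B \<in> sets G" "B \<subseteq> {\<omega>. \<xi> n \<omega> = e}" and i: "i \<ge> 1"
  shows "measure M (B \<inter> {\<omega>\<in>space M. X n i \<omega> \<in> A}) = measure M B * measure_pmf.prob (p e) A"
proof (cases "measure M B = 0")
  case True
  have "measure M (B \<inter> {\<omega>\<in>space M. X n i \<omega> \<in> A}) \<le> measure M B"
    using B i by (intro finite_measure_mono) auto
  then show ?thesis using True by (simp add: measure_le_0_iff)
next
  case False
  have [measurable]: "B \<in> sets M" using B sets_G_D by auto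
  note [measurable] = X_measurable[OF i]
  let ?U = "uniform_measure M B"
  have pos: "emeasure M B \<noteq> 0" "emeasure M B \<noteq> \<infinity>"
    using False by (auto simp: emeasure_eq_measure)
  have U: "measure ?U C = measure M (B \<inter> C) / measure M B" if "C \<in> sets M" for C
    using that pos by (simp add: measure_uniform_measure)
  have Xm: "X n i \<in> measurable ?U (count_space UNIV)" by simp
  interpret U: prob_space ?U by (rule prob_space_uniform_measure[OF pos])
  have "distr ?U (count_space UNIV) (X n i) = measure_pmf (p e)"
  proof (rule measure_eqI_countable[where A = UNIV])
    fix k
    let ?C = "{\<omega>\<in>space M. X n i \<omega> = k}"
    have "measure M (B \<inter> ?C) = (\<integral>\<omega>\<in>B. quenched_prob M E \<xi> ?C \<omega> \<partial>M)"
      using B by (intro quenched_integral) auto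
    also have "\<dots> = measure M B * pmf (p e) k"
      using offspring_law[OF i, of n k] B
      by (intro set_integral_AE_const) (auto elim!: eventually_mono)
    finally have "measure ?U ?C = pmf (p e) k"
      using False U[of ?C] by simp
    moreover have "X n i -` {k} \<inter> space ?U = ?C" by auto
    ultimately show "emeasure (distr ?U (count_space UNIV) (X n i)) {k} = emeasure (measure_pmf (p e)) {k}"
      using Xm by (subst emeasure_distr) (auto simp: U.emeasure_eq_measure emeasure_pmf_single)
  qed auto
  then have "measure_pmf.prob (p e) A = measure (distr ?U (count_space UNIV) (X n i)) A" by simp
  also have "\<dots> = measure ?U {\<omega>\<in>space M. X n i \<omega> \<in> A}"
    using Xm by (subst measure_distr) (auto intro!: arg_cong[where f = "measure ?U"])
  finally show ?thesis using False by (subst (asm) U) auto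
qed

text \<open>Integrals over environment events \<open>B\<close> characterise a conditional
  expectation. Splitting \<open>B\<close> by the finitely many values of \<open>\<xi> n\<close>
  makes the right-hand side constant on each piece.\<close>

lemma quenched_offspring_law:
  assumes i: "i \<ge> 1"
  shows "AE \<omega> in M. quenched_prob M E \<xi> {\<omega>\<in>space M. X n i \<omega> \<in> A} \<omega> = measure_pmf.prob (p (\<xi> n \<omega>)) A"
  unfolding quenched_prob_def
proof (rule G.real_cond_exp_charact)
  note [measurable] = X_measurable[OF i]
  let ?C = "{\<omega>\<in>space M. X n i \<omega> \<in> A}"
  show "integrable M (indicator ?C :: 'a \<Rightarrow> real)"
    by (auto simp: integrable_real_indicator less_top[symmetric])
  show gG: "(\<lambda>\<omega>. measure_pmf.prob (p (\<xi> n \<omega>)) A) \<in> borel_measurable G"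
    by (rule env_fun_measurable_G)
  have gM [measurable]: "(\<lambda>\<omega>. measure_pmf.prob (p (\<xi> n \<omega>)) A) \<in> borel_measurable M"
    by (rule env_fun_measurable)
  show gi: "integrable M (\<lambda>\<omega>. measure_pmf.prob (p (\<xi> n \<omega>)) A)"
    by (rule integrable_const_bound[where B = 1]) auto
  fix B assume B: "B \<in> sets G"
  then have [measurable]: "B \<in> sets M" by auto
  define K where "K e = B \<inter> {\<omega>\<in>space M. \<xi> n \<omega> = e}" for e
  have K: "K e \<in> sets G" for e unfolding K_def using B env_eq_in_G by auto
  then have KM [measurable]: "K e \<in> sets M" for e by auto
  have BK: "B = (\<Union>e\<in>S. K e)"
    using sets.sets_into_space[OF B] env_in_S by (auto simp: K_def)
  have disj: "disjoint_family_on K S" by (auto simp: disjoint_family_on_def K_def)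
  have split: "(\<integral>\<omega>\<in>B. h \<omega> \<partial>M) = (\<Sum>e\<in>S. \<integral>\<omega>\<in>K e. h \<omega> \<partial>M)" if "integrable M h" for h :: "'a \<Rightarrow> real"
    unfolding BK using that disj KM
    by (intro set_integral_finite_Union finite_S)
      (auto simp: set_integrable_def intro!: integrable_mult_indicator[where 'b = real, simplified])
  have "(\<integral>\<omega>\<in>K e. indicator ?C \<omega> \<partial>M) = (\<integral>\<omega>\<in>K e. measure_pmf.prob (p (\<xi> n \<omega>)) A \<partial>M)" for e
  proof -
    have "(\<integral>\<omega>\<in>K e. indicator ?C \<omega> \<partial>M) = (\<integral>\<omega>. indicator (K e \<inter> ?C) \<omega> \<partial>M)"
      unfolding set_lebesgue_integral_def by (intro Bochner_Integration.integral_cong) (auto simp: indicator_def)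
    also have "\<dots> = measure M (K e \<inter> ?C)" by simp
    also have "\<dots> = measure M (K e) * measure_pmf.prob (p e) A"
      by (rule offspring_law_on[OF K _ i]) (auto simp: K_def)
    also have "\<dots> = (\<integral>\<omega>\<in>K e. measure_pmf.prob (p (\<xi> n \<omega>)) A \<partial>M)"
      by (rule set_integral_AE_const[symmetric, OF KM _ gM]) (auto simp: K_def)
    finally show ?thesis .
  qed
  then show "(\<integral>\<omega>\<in>B. indicator ?C \<omega> \<partial>M) = (\<integral>\<omega>\<in>B. measure_pmf.prob (p (\<xi> n \<omega>)) A \<partial>M)"
    using gi by (subst (1 2) split) (auto simp: integrable_real_indicator less_top[symmetric])
qed

text \<open>On the cylinder the quenched marginals are almost surely the constants
  \<open>measure_pmf.prob (p (x n)) (A n i)\<close>, so conditional independence integrates to a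
  product.\<close>

lemma joint_law_on:
  assumes B: "B \<in> sets G" "B \<subseteq> cyl x N" and J: "finite J" "J \<subseteq> {..<N} \<times> {1..}"
  shows "measure M (B \<inter> {\<omega>\<in>space M. \<forall>(n, i)\<in>J. X n i \<omega> \<in> A n i})
    = measure M B * (\<Prod>(n, i)\<in>J. measure_pmf.prob (p (x n)) (A n i))"
proof -
  have [measurable]: "B \<in> sets M" using B by auto
  let ?C = "{\<omega>\<in>space M. \<forall>(n, i)\<in>J. X n i \<omega> \<in> A n i}"
  have C: "?C \<in> sets M"
  proof -
    have "{\<omega>\<in>space M. \<forall>j\<in>J. X (fst j) (snd j) \<omega> \<in> A (fst j) (snd j)} \<in> sets M"
    proof (rule sets.sets_Collect_finite_All[OF _ J(1)])
      fix j assume "j \<in> J"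
      then have [measurable]: "X (fst j) (snd j) \<in> measurable M (count_space UNIV)"
        using J by (intro X_measurable) auto
      show "{\<omega>\<in>space M. X (fst j) (snd j) \<omega> \<in> A (fst j) (snd j)} \<in> sets M" by simp
    qed
    then show ?thesis by (simp add: case_prod_beta)
  qed
  have "AE \<omega> in M. \<forall>j\<in>J. quenched_prob M E \<xi> {\<omega>\<in>space M. X (fst j) (snd j) \<omega> \<in> A (fst j) (snd j)} \<omega>
      = measure_pmf.prob (p (\<xi> (fst j) \<omega>)) (A (fst j) (snd j))"
    using J by (intro AE_finite_allI quenched_offspring_law) auto
  moreover have "AE \<omega> in M. quenched_prob M E \<xi> ?C \<omega>
      = (\<Prod>(n, i)\<in>J. quenched_prob M E \<xi> {\<omega>'\<in>space M. X n i \<omega>' \<in> A n i} \<omega>)"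
    using J by (intro offspring_cond_indep) auto
  ultimately have "AE \<omega> in M. \<omega> \<in> B \<longrightarrow> quenched_prob M E \<xi> ?C \<omega>
      = (\<Prod>(n, i)\<in>J. measure_pmf.prob (p (x n)) (A n i))"
  proof eventually_elim
    case (elim \<omega>)
    have "\<xi> (fst j) \<omega> = x (fst j)" if "\<omega> \<in> B" "j \<in> J" for j
    proof -
      have "fst j < N" using that(2) J by auto
      then show ?thesis using that(1) B by (auto simp: cyl_def)
    qed
    then show ?case using elim by (auto simp: case_prod_beta intro!: prod.cong)
  qed
  then show ?thesis
    using quenched_integral[OF C B(1)] set_integral_AE_const[of B] by simp
qed

text \<open>Normalising \<open>M\<close> on \<open>B\<close> turns conditional independence into
  ordinary independence, so that the unconditional computations with generating functions
  apply.\<close>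

lemma indep_on_cyl:
  assumes B: "B \<in> sets G" "B \<subseteq> cyl x N" and pos: "emeasure M B \<noteq> 0"
  shows "prob_space.indep_vars (uniform_measure M B) (\<lambda>_. count_space UNIV) (\<lambda>(n, i). X n i) ({..<N} \<times> {1..})"
    and "n < N \<Longrightarrow> i \<ge> 1 \<Longrightarrow> distr (uniform_measure M B) (count_space UNIV) (X n i) = measure_pmf (p (x n))"
proof -
  let ?U = "uniform_measure M B"
  have [measurable]: "B \<in> sets M" using B by auto
  interpret U: prob_space ?U by (rule prob_space_uniform_measure[OF pos]) (auto simp: emeasure_eq_measure)
  have B0: "measure M B \<noteq> 0" using pos by (simp add: emeasure_eq_measure)
  have U: "measure ?U C = measure M (B \<inter> C) / measure M B" if "C \<in> sets M" for C
    using that pos by (simp add: measure_uniform_measure emeasure_eq_measure)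
  have Xm: "X n i \<in> measurable ?U (count_space UNIV)" if "i \<ge> 1" for n i
    using X_measurable[OF that] by simp
  have one: "measure ?U {\<omega>\<in>space M. X n i \<omega> \<in> A} = measure_pmf.prob (p (x n)) A"
    if "n < N" "i \<ge> 1" for n i A
  proof -
    have "measure M (B \<inter> {\<omega>\<in>space M. X n i \<omega> \<in> A}) = measure M B * measure_pmf.prob (p (x n)) A"
      using B that by (intro offspring_law_on) (auto simp: cyl_def)
    then show ?thesis using B0 X_measurable[OF that(2), of n] by (subst U) auto
  qed
  show "U.indep_vars (\<lambda>_. count_space UNIV) (\<lambda>(n, i). X n i) ({..<N} \<times> {1..})"
    unfolding U.indep_vars_def2
  proof (intro conjI U.indep_setsI)
    show "\<forall>i\<in>{..<N} \<times> {1..}. (case i of (n, i) \<Rightarrow> X n i) \<in> measurable ?U (count_space UNIV)"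
      using Xm by auto
    show "{(case i of (n, i) \<Rightarrow> X n i) -` A \<inter> space ?U |A. A \<in> sets (count_space UNIV)} \<subseteq> sets ?U"
      if mem: "i \<in> {..<N} \<times> {1..}" for i
    proof -
      obtain n l where i: "i = (n, l)" "l \<ge> 1" using mem by (cases i) auto
      then show ?thesis using measurable_sets[OF Xm[OF i(2), of n]] by auto
    qed
    fix A J assume J: "J \<noteq> {}" "J \<subseteq> {..<N} \<times> {1..}" "finite J"
      and A: "\<forall>j\<in>J. A j \<in> {(case j of (n, i) \<Rightarrow> X n i) -` A \<inter> space ?U |A. A \<in> sets (count_space UNIV)}"
    then have "\<forall>j\<in>J. \<exists>A'. A j = {\<omega>\<in>space M. X (fst j) (snd j) \<omega> \<in> A'}"
      by (fastforce simp: case_prod_beta)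
    then obtain A' where A': "\<And>j. j \<in> J \<Longrightarrow> A j = {\<omega>\<in>space M. X (fst j) (snd j) \<omega> \<in> A' j}"
      by metis
    have eq: "(\<Inter>j\<in>J. A j) = {\<omega>\<in>space M. \<forall>(n, i)\<in>J. X n i \<omega> \<in> A' (n, i)}"
      using J A' by fastforce
    have "(\<Inter>j\<in>J. A j) \<in> sets M"
    proof (rule sets.finite_INT[OF J(3,1)])
      fix j assume j: "j \<in> J"
      then have [measurable]: "X (fst j) (snd j) \<in> measurable M (count_space UNIV)"
        using J by (intro X_measurable) auto
      show "A j \<in> sets M" unfolding A'[OF j] by simp
    qed
    then have "measure ?U (\<Inter>j\<in>J. A j) = measure M (B \<inter> (\<Inter>j\<in>J. A j)) / measure M B" by (rule U)
    also have "\<dots> = (\<Prod>(n, i)\<in>J. measure_pmf.prob (p (x n)) (A' (n, i)))"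
      unfolding eq using joint_law_on[OF B J(3,2), of "\<lambda>n i. A' (n, i)"] B0 by simp
    also have "\<dots> = (\<Prod>j\<in>J. measure ?U (A j))"
      using J by (intro prod.cong) (auto simp: A' one)
    finally show "measure ?U (\<Inter>j\<in>J. A j) = (\<Prod>j\<in>J. measure ?U (A j))" .
  qed
  show "distr ?U (count_space UNIV) (X n i) = measure_pmf (p (x n))" if "n < N" "i \<ge> 1"
  proof (rule measure_eqI_countable[where A = UNIV])
    fix k
    have "X n i -` {k} \<inter> space ?U = {\<omega>\<in>space M. X n i \<omega> \<in> {k}}" by auto
    then show "emeasure (distr ?U (count_space UNIV) (X n i)) {k} = emeasure (measure_pmf (p (x n))) {k}"
      using Xm[OF that(2)] one[OF that, of "{k}"]
      by (subst emeasure_distr) (auto simp: U.emeasure_eq_measure measure_pmf.emeasure_eq_measure)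
  qed auto
qed

text \<open>\<open>B\<close> ranges over all environment events inside the cylinder and not just the
  cylinder itself, because a quenched inequality is proved by testing against every environment
  event.\<close>

lemma pgf_on_cyl:
  fixes \<phi> :: "nat \<Rightarrow> ennreal"
  assumes B: "B \<in> sets G" "B \<subseteq> cyl x (n + l)"
  shows "(\<integral>\<^sup>+\<omega>\<in>B. \<phi> (Z n \<omega>) * s ^ Z (n + l) \<omega> \<partial>M)
       = (\<integral>\<^sup>+\<omega>\<in>B. \<phi> (Z n \<omega>) * pgf_comp (p \<circ> x) n l s ^ Z n \<omega> \<partial>M)"
proof (cases "emeasure M B = 0")
  case True
  then have "AE \<omega> in M. \<omega> \<notin> B" using B by (intro AE_not_in) auto
  then have "(\<integral>\<^sup>+\<omega>\<in>B. f \<omega> \<partial>M) = 0" for f :: "'a \<Rightarrow> ennreal"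
    by (subst nn_integral_cong_AE[where v = "\<lambda>_. 0"]) (auto elim!: eventually_mono)
  then show ?thesis by simp
next
  case False
  have [measurable]: "B \<in> sets M" using B by auto
  have fin: "emeasure M B \<noteq> \<infinity>" by (simp add: emeasure_eq_measure)
  interpret U: prob_space "uniform_measure M B" by (rule prob_space_uniform_measure[OF False fin])
  have "(\<integral>\<^sup>+\<omega>. \<phi> (Z n \<omega>) * s ^ Z (n + l) \<omega> \<partial>uniform_measure M B)
     = (\<integral>\<^sup>+\<omega>. \<phi> (Z n \<omega>) * pgf_comp (p \<circ> x) n l s ^ Z n \<omega> \<partial>uniform_measure M B)"
    by (rule U.pgf_generations[OF indep_on_cyl(1)[OF B False]])
      (auto simp: indep_on_cyl(2)[OF B False])
  moreover have eq: "(\<integral>\<^sup>+\<omega>\<in>B. f \<omega> \<partial>M) = emeasure M B * (\<integral>\<^sup>+\<omega>. f \<omega> \<partial>uniform_measure M B)"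
    if [measurable]: "f \<in> borel_measurable M" for f
  proof -
    have "(\<integral>\<^sup>+\<omega>\<in>B. f \<omega> \<partial>M) = (\<integral>\<^sup>+\<omega>\<in>B. f \<omega> \<partial>M) * emeasure M B / emeasure M B"
      using False fin by (intro mult_divide_eq_ennreal[symmetric]) auto
    then show ?thesis
      by (subst nn_integral_uniform_measure) (auto simp: ennreal_times_divide mult.commute)
  qed
  ultimately show ?thesis by (subst (1 2) eq) auto
qed

abbreviation "Wn \<equiv> bp_W \<xi> p X"

text \<open>Cylinders of length \<open>N\<close> split \<open>B\<close> into finitely many disjoint
  pieces, thanks to the finite state space, and the inequalities add up.\<close>

lemma set_nn_integral_le_by_cyl:
  assumes B: "B \<in> sets G" and [measurable]: "U \<in> borel_measurable M" "V \<in> borel_measurable M"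
    and le: "\<And>x. (\<integral>\<^sup>+\<omega>\<in>B \<inter> cyl x N. U \<omega> \<partial>M) \<le> (\<integral>\<^sup>+\<omega>\<in>B \<inter> cyl x N. V \<omega> \<partial>M)"
  shows "(\<integral>\<^sup>+\<omega>\<in>B. U \<omega> \<partial>M) \<le> (\<integral>\<^sup>+\<omega>\<in>B. V \<omega> \<partial>M)"
proof -
  define I where "I = PiE {..<N} (\<lambda>_. S)"
  have fin: "finite I" unfolding I_def by (intro finite_PiE finite_S) auto
  have [measurable]: "B \<in> sets M" "cyl x N \<in> sets M" for x using B cyl_in_G by auto
  have split: "(\<integral>\<^sup>+\<omega>\<in>B. h \<omega> \<partial>M) = (\<Sum>x\<in>I. \<integral>\<^sup>+\<omega>\<in>B \<inter> cyl x N. h \<omega> \<partial>M)"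
    if [measurable]: "h \<in> borel_measurable M" for h :: "'a \<Rightarrow> ennreal"
  proof -
    have "(\<integral>\<^sup>+\<omega>\<in>B. h \<omega> \<partial>M) = (\<integral>\<^sup>+\<omega>. (\<Sum>x\<in>I. h \<omega> * indicator (B \<inter> cyl x N) \<omega>) \<partial>M)"
    proof (rule nn_integral_cong)
      fix \<omega> assume \<omega>: "\<omega> \<in> space M"
      \<comment> \<open>The environment prefix of \<open>\<omega>\<close>, extended by
        \<open>undefined\<close>, indexes the only cylinder from \<open>I\<close> that contains
        \<open>\<omega>\<close>.\<close>
      define y where "y = restrict (\<lambda>j. \<xi> j \<omega>) {..<N}"
      have y: "y \<in> I" using env_in_S[OF \<omega>] by (auto simp: I_def y_def)
      have "\<omega> \<in> cyl x N \<longleftrightarrow> x = y" if "x \<in> I" for x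
        using that \<omega> by (auto simp: cyl_def y_def I_def PiE_iff extensional_def fun_eq_iff)
      then have "(\<Sum>x\<in>I. h \<omega> * indicator (B \<inter> cyl x N) \<omega>) = (\<Sum>x\<in>I. if x = y then h \<omega> * indicator B \<omega> else 0)"
        by (intro sum.cong) (auto simp: indicator_def)
      also have "\<dots> = h \<omega> * indicator B \<omega>" using fin y by simp
      finally show "h \<omega> * indicator B \<omega> = (\<Sum>x\<in>I. h \<omega> * indicator (B \<inter> cyl x N) \<omega>)" ..
    qed
    also have "\<dots> = (\<Sum>x\<in>I. \<integral>\<^sup>+\<omega>\<in>B \<inter> cyl x N. h \<omega> \<partial>M)"
      by (rule nn_integral_sum) measurable
    finally show ?thesis .
  qed
  show ?thesis by (subst (1 2) split) (auto intro!: sum_mono le)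
qed

section \<open>Stationarity and the states of positive probability\<close>

lemma measure_env_eq: "measure M {\<omega>\<in>space M. \<xi> n \<omega> = e} = measure M {\<omega>\<in>space M. \<xi> 0 \<omega> = e}"
proof (induction n)
  case (Suc n)
  let ?C = "{y \<in> space (env_space E). y n = e}"
  have comp: "(\<lambda>y. y n) \<in> measurable (env_space E) E" for n
    unfolding env_space_def by (rule measurable_component_singleton) simp
  have "(\<lambda>y. y n) -` ({e} \<inter> S) \<inter> space (env_space E) \<in> sets (env_space E)"
    by (rule measurable_sets[OF comp]) (simp add: E_eq)
  moreover have "(\<lambda>y. y n) -` ({e} \<inter> S) \<inter> space (env_space E) = ?C"
    by (auto simp: env_space_def space_PiM)
  ultimately have C: "?C \<in> sets (env_space E)" by simp
  have sp: "env_seq \<xi> \<omega> \<in> space (env_space E)" "env_shift (env_seq \<xi> \<omega>) \<in> space (env_space E)"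
    if "\<omega> \<in> space M" for \<omega>
    using env_in_S[OF that] by (auto simp: env_space_def space_PiM env_seq_def env_shift_def)
  have shift: "(\<lambda>\<omega>. env_shift (env_seq \<xi> \<omega>)) \<in> measurable M (env_space E)"
    unfolding env_seq_def env_space_def env_shift_def
    by (intro measurable_PiM_single') (auto simp: env_measurable env_in_S)
  have "measure M {\<omega>\<in>space M. \<xi> (Suc n) \<omega> = e}
      = measure (distr M (env_space E) (\<lambda>\<omega>. env_shift (env_seq \<xi> \<omega>))) ?C"
    using sp by (subst measure_distr[OF shift C]) (auto simp: env_shift_def env_seq_def intro!: arg_cong[where f = "measure M"])
  also have "\<dots> = measure (distr M (env_space E) (env_seq \<xi>)) ?C"
    using env_stationary by (simp add: stationary_def)
  also have "\<dots> = measure M {\<omega>\<in>space M. \<xi> n \<omega> = e}"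
    using sp by (subst measure_distr[OF env_seq_measurable C]) (auto simp: env_seq_def intro!: arg_cong[where f = "measure M"])
  finally show ?case using Suc by simp
qed simp

text \<open>By stationarity every \<open>\<xi> n\<close> almost surely takes values in this set, so
  almost sure assumptions on \<open>\<xi> 0\<close> become pointwise assumptions on finitely many
  states.\<close>

definition essential_states :: "'e set" where
  "essential_states = {e\<in>S. measure M {\<omega>\<in>space M. \<xi> 0 \<omega> = e} > 0}"

lemma finite_essential_states: "finite essential_states"
  using finite_S by (simp add: essential_states_def)

lemma AE_essential_states: "AE \<omega> in M. \<forall>n. \<xi> n \<omega> \<in> essential_states"
proof -
  have "AE \<omega> in M. \<xi> n \<omega> \<noteq> e" if "e \<in> S - essential_states" for n e
  proof -
    have "measure M {\<omega>\<in>space M. \<xi> n \<omega> = e} = 0"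
      using that by (subst measure_env_eq) (auto simp: essential_states_def less_le)
    then have "{\<omega>\<in>space M. \<xi> n \<omega> = e} \<in> null_sets M"
      using env_eq_in_G[of n e] by (auto simp: null_sets_def emeasure_eq_measure)
    from AE_not_in[OF this] show ?thesis by (auto simp: AE_space intro: AE_mp[OF AE_space])
  qed
  then have "AE \<omega> in M. \<forall>n. \<forall>e\<in>S - essential_states. \<xi> n \<omega> \<noteq> e"
    using finite_S by (subst AE_all_countable) (auto intro!: AE_finite_allI)
  then show ?thesis using AE_space
    by eventually_elim (use env_in_S in fastforce)
qed

text \<open>An essential state is attained with positive probability and cannot hide in an
  exceptional null set; conversely \<open>\<xi> 0\<close> is almost surely essential.\<close>

lemma AE_env_iff:
  "(AE \<omega> in M. P (\<xi> 0 \<omega>)) \<longleftrightarrow> (\<forall>e\<in>essential_states. P e)"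
proof
  assume P: "AE \<omega> in M. P (\<xi> 0 \<omega>)"
  show "\<forall>e\<in>essential_states. P e"
  proof (rule ballI, rule ccontr)
    fix e assume e: "e \<in> essential_states" "\<not> P e"
    have "AE \<omega> in M. \<omega> \<notin> {\<omega>\<in>space M. \<xi> 0 \<omega> = e}"
      using P by eventually_elim (use e in auto)
    then have "measure M {\<omega>\<in>space M. \<xi> 0 \<omega> = e} = 0"
      using env_eq_in_G[of 0 e] by (subst (asm) AE_iff_measurable[OF _ refl]) (auto simp: emeasure_eq_measure Int_def cong: conj_cong)
    then show False using e by (simp add: essential_states_def)
  qed
next
  assume "\<forall>e\<in>essential_states. P e"
  then show "AE \<omega> in M. P (\<xi> 0 \<omega>)"
    using AE_essential_states by (auto elim!: eventually_mono)
qed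

lemma essential_states_nonempty: "essential_states \<noteq> {}"
proof
  assume "essential_states = {}"
  then have "AE \<omega> in M. False" using AE_env_iff[of "\<lambda>_. False"] by simp
  then show False by simp
qed

text \<open>The almost sure lower bounds form the half-line up to the minimum, so the real supremum
  in \<open>essinf\<close> is attained and not a default value.\<close>

lemma essinf_eq_Min: "essinf M (env_mean \<xi> p 0) = Min (m ` essential_states)"
proof -
  have "{c. AE \<omega> in M. c \<le> env_mean \<xi> p 0 \<omega>} = {c. \<forall>e\<in>essential_states. c \<le> m e}"
    unfolding env_mean_def using AE_env_iff[of "\<lambda>e. c \<le> m e" for c] by auto
  also have "\<dots> = {..Min (m ` essential_states)}"
    using finite_essential_states essential_states_nonempty by (simp add: atMost_def)
  finally show ?thesis by (simp add: essinf_def)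
qed

text \<open>The one-step estimates are available at essential states only; cylinders through any
  other state drop out of every integral.\<close>

lemma null_cyl_of_inessential:
  assumes "j < N" "x j \<notin> essential_states"
  shows "emeasure M (cyl x N) = 0"
proof -
  have "AE \<omega> in M. \<omega> \<notin> cyl x N"
    using AE_essential_states
  proof eventually_elim
    case (elim \<omega>)
    then have "\<xi> j \<omega> \<noteq> x j" using assms(2) by metis
    then show ?case using assms(1) by (auto simp: cyl_def)
  qed
  then show ?thesis
    using cyl_in_G[of x N] by (subst (asm) AE_iff_null_sets[symmetric]) auto
qed

section \<open>Transforms of the normalised population\<close>

lemma Pi_on_cyl: "\<omega> \<in> cyl x N \<Longrightarrow> k \<le> N \<Longrightarrow> \<Pi>w k \<omega> = (\<Prod>j<k. m (x j))"
  unfolding bp_Pi_def env_mean_def by (intro prod.cong) (auto simp: cyl_def)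

lemma Pi_pos: "\<omega> \<in> space M \<Longrightarrow> \<Pi>w k \<omega> > 0"
  unfolding bp_Pi_def env_mean_def using env_in_S mean_positive by (intro prod_pos) auto

lemma Pi_measurable_G: "\<Pi>w k \<in> borel_measurable G"
proof -
  have [measurable]: "(\<lambda>\<omega>. env_mean \<xi> p i \<omega>) \<in> borel_measurable G" for i
    unfolding env_mean_def by (rule env_fun_measurable_G)
  show ?thesis unfolding bp_Pi_def[abs_def] by measurable
qed

lemma Pi_measurable [measurable]: "\<Pi>w k \<in> borel_measurable M"
  using measurable_from_subalg[OF subalgebra_G Pi_measurable_G] .

lemma Wn_measurable [measurable]: "Wn k \<in> borel_measurable M"
  unfolding bp_W_def[abs_def] by measurable

text \<open>Controls the normalised population of one ancestor uniformly in its generation, in the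
  number of generations elapsed and in the environment. The coefficient 1 of \<open>t\<close> is the
  mean of that population.\<close>

definition mgf_controlled :: "real \<Rightarrow> real \<Rightarrow> bool" where
  "mgf_controlled c D \<longleftrightarrow> c > 0 \<and> D \<ge> 0 \<and> (\<forall>x n l t. (\<forall>j\<in>{n..<n + l}. x j \<in> essential_states) \<longrightarrow> \<bar>t\<bar> \<le> c \<longrightarrow>
    pgf_comp (p \<circ> x) n l (ennreal (exp (t / (\<Prod>j=n..<n + l. m (x j))))) \<le> ennreal (exp (t + D * t\<^sup>2)))"

text \<open>In \<open>\<Pi>w n * Wn (n + l)\<close> the means of the first \<open>n\<close>
  generations cancel. What remains is \<open>Z (n + l)\<close> divided by a constant of the
  cylinder.\<close>

lemma exp_Pi_Wn_on_cyl:
  assumes "\<omega> \<in> cyl x (n + l)"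
  shows "ennreal (exp (t * \<Pi>w n \<omega> * Wn (n + l) \<omega>))
    = ennreal (exp (t / (\<Prod>j=n..<n + l. m (x j)))) ^ Z (n + l) \<omega>"
proof -
  have "\<omega> \<in> space M" using assms by (simp add: cyl_def)
  have split: "(\<Prod>j<n + l. m (x j)) = (\<Prod>j<n. m (x j)) * (\<Prod>j=n..<n + l. m (x j))"
    using prod.atLeastLessThan_concat[of 0 n "n + l" "\<lambda>j. m (x j)"] by (simp add: lessThan_atLeast0)
  have "\<Pi>w n \<omega> > 0" using Pi_pos[OF \<open>\<omega> \<in> space M\<close>] .
  moreover have "\<Pi>w n \<omega> = (\<Prod>j<n. m (x j))" "\<Pi>w (n + l) \<omega> = (\<Prod>j<n + l. m (x j))"
    using Pi_on_cyl[OF assms] by auto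
  ultimately have "\<Pi>w (n + l) \<omega> = \<Pi>w n \<omega> * (\<Prod>j=n..<n + l. m (x j))" "\<Pi>w n \<omega> \<noteq> 0"
    by (auto simp only: split)
  then have "t * \<Pi>w n \<omega> * Wn (n + l) \<omega> = t / (\<Prod>j=n..<n + l. m (x j)) * real (Z (n + l) \<omega>)"
    unfolding bp_W_def by (simp del: prod_zero_iff)
  then show ?thesis
    by (simp add: ennreal_power exp_of_nat_mult[symmetric] mult.commute)
qed

text \<open>Cylinders through an inessential state are null; otherwise the branching property at
  time \<open>n\<close> contributes one factor, bounded uniformly, for each of the
  \<open>Z n\<close> individuals.\<close>

lemma mgf_on_cyl:
  fixes \<phi> :: "nat \<Rightarrow> ennreal"
  assumes ctrl: "mgf_controlled c D" and t: "\<bar>t\<bar> \<le> c" and B: "B \<in> sets G" "B \<subseteq> cyl x (n + l)"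
  shows "(\<integral>\<^sup>+\<omega>\<in>B. \<phi> (Z n \<omega>) * ennreal (exp (t * \<Pi>w n \<omega> * Wn (n + l) \<omega>)) \<partial>M)
    \<le> (\<integral>\<^sup>+\<omega>\<in>B. \<phi> (Z n \<omega>) * ennreal (exp ((t + D * t\<^sup>2) * real (Z n \<omega>))) \<partial>M)"
proof (cases "\<forall>j<n + l. x j \<in> essential_states")
  case False
  then have "emeasure M (cyl x (n + l)) = 0" using null_cyl_of_inessential by auto
  then have "AE \<omega> in M. \<omega> \<notin> cyl x (n + l)" using cyl_in_G[of x "n + l"] by (intro AE_not_in) auto
  then have "AE \<omega> in M. \<omega> \<notin> B" using B by (auto elim!: eventually_mono)
  then have "(\<integral>\<^sup>+\<omega>\<in>B. f \<omega> \<partial>M) = 0" for f :: "'a \<Rightarrow> ennreal"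
    by (subst nn_integral_cong_AE[where v = "\<lambda>_. 0"]) (auto elim!: eventually_mono)
  then show ?thesis by simp
next
  case True
  let ?s = "ennreal (exp (t / (\<Prod>j=n..<n + l. m (x j))))"
  have pow: "ennreal (exp u) ^ k = ennreal (exp (u * real k))" for u k
    by (simp add: ennreal_power exp_of_nat_mult[symmetric] mult.commute)
  have "(\<integral>\<^sup>+\<omega>\<in>B. \<phi> (Z n \<omega>) * ennreal (exp (t * \<Pi>w n \<omega> * Wn (n + l) \<omega>)) \<partial>M)
      = (\<integral>\<^sup>+\<omega>\<in>B. \<phi> (Z n \<omega>) * ?s ^ Z (n + l) \<omega> \<partial>M)"
    using B by (intro nn_integral_cong) (auto simp: indicator_def exp_Pi_Wn_on_cyl)
  also have "\<dots> = (\<integral>\<^sup>+\<omega>\<in>B. \<phi> (Z n \<omega>) * pgf_comp (p \<circ> x) n l ?s ^ Z n \<omega> \<partial>M)"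
    by (rule pgf_on_cyl[OF B])
  also have "\<dots> \<le> (\<integral>\<^sup>+\<omega>\<in>B. \<phi> (Z n \<omega>) * ennreal (exp ((t + D * t\<^sup>2) * real (Z n \<omega>))) \<partial>M)"
  proof -
    have "pgf_comp (p \<circ> x) n l ?s \<le> ennreal (exp (t + D * t\<^sup>2))"
      using ctrl t True unfolding mgf_controlled_def by auto
    then show ?thesis unfolding pow[symmetric]
      by (intro nn_integral_mono mult_right_mono mult_left_mono power_mono) auto
  qed
  finally show ?thesis .
qed

text \<open>The case of the single ancestor in generation 0. That the bound is free of
  \<open>n\<close> is what permits the passage to \<open>W\<close>.\<close>

lemma exp_moment_le:
  assumes "mgf_controlled c D" "B \<in> sets G"
  shows "(\<integral>\<^sup>+\<omega>\<in>B. ennreal (exp (c * Wn n \<omega>)) \<partial>M) \<le> (\<integral>\<^sup>+\<omega>\<in>B. ennreal (exp (c + D * c\<^sup>2)) \<partial>M)"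
proof (rule set_nn_integral_le_by_cyl[OF assms(2)])
  fix x
  have "c > 0" using assms by (simp add: mgf_controlled_def)
  then show "(\<integral>\<^sup>+\<omega>\<in>B \<inter> cyl x n. ennreal (exp (c * Wn n \<omega>)) \<partial>M)
     \<le> (\<integral>\<^sup>+\<omega>\<in>B \<inter> cyl x n. ennreal (exp (c + D * c\<^sup>2)) \<partial>M)"
    using mgf_on_cyl[OF assms(1), of c "B \<inter> cyl x n" x 0 n "\<lambda>_. 1"] assms(2) cyl_in_G[of x n]
    by (simp add: bp_Pi_def)
qed auto

end

section \<open>Exponential moments and concentration\<close>

context finite_env_branching
begin

text \<open>Each event \<open>\<xi> 0 = e\<close> with \<open>e\<close> essential has positive
  probability, so the exponential moment of \<open>Wn 1\<close> passes to the offspring law of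
  \<open>e\<close>. The one-step bound and then the composition bound apply, with constants common
  to the finitely many states.\<close>

lemma ex_mgf_controlled:
  assumes m1: "\<And>e. e \<in> essential_states \<Longrightarrow> m e > 1"
    and W1: "\<theta> > 0" "has_exp_moment M (Wn 1) \<theta>"
  shows "\<exists>c D. mgf_controlled c D"
proof -
  have one: "\<exists>A\<ge>0. \<exists>\<tau>>0. \<forall>t. \<bar>t\<bar> \<le> \<tau> \<longrightarrow> pgf (p e) (ennreal (exp (t / m e))) \<le> ennreal (exp (t + A * t\<^sup>2))"
    if e: "e \<in> essential_states" for e
  proof (rule pgf_exp_bound)
    have eS: "e \<in> S" using e by (simp add: essential_states_def)
    show "summable (\<lambda>i. real i * pmf (p e) i)" "m e > 0"
      using mean_finite mean_positive eS by auto
    then show "\<theta> / m e > 0" using W1 by simp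
    let ?B = "{\<omega>\<in>space M. \<xi> 0 \<omega> = e}"
    have B: "?B \<in> sets G" by (rule env_eq_in_G)
    have "(\<integral>\<^sup>+\<omega>\<in>?B. ennreal (exp (\<theta> * Wn 1 \<omega>)) \<partial>M) \<le> (\<integral>\<^sup>+\<omega>. ennreal (exp (\<theta> * Wn 1 \<omega>)) \<partial>M)"
      by (intro nn_integral_mono) (auto simp: indicator_def)
    also have "\<dots> < \<infinity>" using W1 by (simp add: has_exp_moment_def)
    finally have fin: "(\<integral>\<^sup>+\<omega>\<in>?B. ennreal (exp (\<theta> * Wn 1 \<omega>)) \<partial>M) < \<infinity>" .
    have "(\<integral>\<^sup>+\<omega>\<in>?B. ennreal (exp (\<theta> * Wn 1 \<omega>)) \<partial>M)
        = (\<integral>\<^sup>+\<omega>\<in>?B. ennreal (exp (\<theta> / m e)) ^ Z (0 + 1) \<omega> \<partial>M)"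
      by (intro nn_integral_cong)
        (auto simp: indicator_def bp_W_def bp_Pi_def env_mean_def ennreal_power exp_of_nat_mult[symmetric] mult.commute)
    also have "\<dots> = (\<integral>\<^sup>+\<omega>\<in>?B. pgf (p e) (ennreal (exp (\<theta> / m e))) \<partial>M)"
      using pgf_on_cyl[OF B, of "\<lambda>_. e" 0 1 "\<lambda>_. 1"] by (simp add: cyl_def)
    also have "\<dots> = pgf (p e) (ennreal (exp (\<theta> / m e))) * emeasure M ?B"
      using B by (intro nn_integral_cmult_indicator) auto
    finally show "pgf (p e) (ennreal (exp (\<theta> / m e))) < \<infinity>"
      using fin e by (auto simp: ennreal_mult_less_top emeasure_eq_measure essential_states_def)
  qed
  \<comment> \<open>Common constants by induction over the states: enlarging \<open>A\<close> and
    shrinking \<open>\<tau>\<close> preserve the one-step bound.\<close>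
  have "\<exists>A\<ge>0. \<exists>\<tau>>0. \<forall>e\<in>F. \<forall>t. \<bar>t\<bar> \<le> \<tau> \<longrightarrow> pgf (p e) (ennreal (exp (t / m e))) \<le> ennreal (exp (t + A * t\<^sup>2))"
    if "finite F" "F \<subseteq> essential_states" for F
    using that
  proof (induction F rule: finite_induct)
    case empty
    then show ?case by (intro exI[of _ 0] conjI exI[of _ 1]) auto
  next
    case (insert e F)
    then obtain A \<tau> where 1: "A \<ge> 0" "\<tau> > 0"
      "\<And>e t. e \<in> F \<Longrightarrow> \<bar>t\<bar> \<le> \<tau> \<Longrightarrow> pgf (p e) (ennreal (exp (t / m e))) \<le> ennreal (exp (t + A * t\<^sup>2))"
      by auto
    obtain A' \<tau>' where 2: "A' \<ge> 0" "\<tau>' > 0"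
      "\<And>t. \<bar>t\<bar> \<le> \<tau>' \<Longrightarrow> pgf (p e) (ennreal (exp (t / m e))) \<le> ennreal (exp (t + A' * t\<^sup>2))"
      using one[of e] insert.prems by auto
    have le: "ennreal (exp (t + a * t\<^sup>2)) \<le> ennreal (exp (t + max A A' * t\<^sup>2))" if "a \<le> max A A'" for a t
      using that by (auto intro!: ennreal_leI mult_right_mono)
    show ?case
    proof (rule exI[of _ "max A A'"], rule conjI, use 1 in simp, rule exI[of _ "min \<tau> \<tau>'"], intro conjI ballI allI impI)
      fix e' t assume "e' \<in> insert e F" "\<bar>t\<bar> \<le> min \<tau> \<tau>'"
      then show "pgf (p e') (ennreal (exp (t / m e'))) \<le> ennreal (exp (t + max A A' * t\<^sup>2))"
        using order_trans[OF 1(3) le] order_trans[OF 2(3) le] by auto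
    qed (use 1 2 in auto)
  qed
  from this[OF finite_essential_states] obtain A \<tau> where A: "A \<ge> 0" "\<tau> > 0"
    "\<And>e t. e \<in> essential_states \<Longrightarrow> \<bar>t\<bar> \<le> \<tau> \<Longrightarrow> pgf (p e) (ennreal (exp (t / m e))) \<le> ennreal (exp (t + A * t\<^sup>2))"
    by auto
  define \<mu> where "\<mu> = Min (m ` essential_states)"
  have "\<mu> > 1" using m1 finite_essential_states essential_states_nonempty by (simp add: \<mu>_def)
  have \<mu>: "m e \<ge> \<mu>" if "e \<in> essential_states" for e
    using that finite_essential_states by (simp add: \<mu>_def)
  define D where "D = 4 * A / (1 - 1 / \<mu>)"
  \<comment> \<open>The two terms secure \<open>2 * c \<le> \<tau>\<close> and
    \<open>D * c \<le> 1\<close>; adding 1 to \<open>D\<close> avoids division by zero.\<close>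
  define c where "c = min (\<tau> / 2) (1 / (D + 1))"
  have D: "D \<ge> 0" using A \<open>\<mu> > 1\<close> by (simp add: D_def)
  have c: "c > 0" using A D by (simp add: c_def)
  have "D * c \<le> D * (1 / (D + 1))" using D by (intro mult_left_mono) (auto simp: c_def)
  also have "\<dots> \<le> 1" using D by simp
  finally have Dc: "D * c \<le> 1" .
  have "mgf_controlled c D"
    unfolding mgf_controlled_def
  proof (intro conjI allI impI c D)
    fix x :: "nat \<Rightarrow> 'e" and n l and t :: real
    assume x: "\<forall>j\<in>{n..<n + l}. x j \<in> essential_states" and "\<bar>t\<bar> \<le> c"
    then show "pgf_comp (p \<circ> x) n l (ennreal (exp (t / (\<Prod>j=n..<n + l. m (x j))))) \<le> ennreal (exp (t + D * t\<^sup>2))"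
      using pgf_comp_exp_bound[OF \<open>\<mu> > 1\<close> A(1) D_def, of c \<tau> n l "p \<circ> x" t] Dc A(3) \<mu>
      by (auto simp: c_def)
  qed
  then show ?thesis by blast
qed

text \<open>The entry \<open>exp c\<close> makes the tail bound at least 1 in the trivial range
  \<open>Y \<le> 1\<close> of \<open>tail_on_cyl\<close>; the other entry sums the contributions of
  a large \<open>Wn n\<close> and of the two one-sided deviations.\<close>

definition tail_const :: "real \<Rightarrow> real \<Rightarrow> real" where
  "tail_const c D = max (exp c) (exp (c + D * c\<^sup>2) + 2 * exp (D * c\<^sup>2))"

text \<open>Chernoff's method with a truncation: given \<open>Z n\<close>, the deviation costs
  \<open>D t^2 Z n\<close> in the exponent, which stays bounded only while \<open>Z n\<close> is not
  too large. The event of a large \<open>Z n\<close> is covered by the exponential moment of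
  \<open>Wn n\<close>.\<close>

lemma tail_on_cyl:
  assumes m1: "\<And>e. e \<in> essential_states \<Longrightarrow> m e > 1"
    and ctrl: "mgf_controlled c D" and B: "B \<in> sets G" "B \<subseteq> cyl x (n + l)" and "\<epsilon> > 0"
  shows "(\<integral>\<^sup>+\<omega>\<in>B. indicator {\<omega>. \<bar>Wn (n + l) \<omega> - Wn n \<omega>\<bar> > \<epsilon>} \<omega> \<partial>M)
    \<le> (\<integral>\<^sup>+\<omega>\<in>B. ennreal (tail_const c D * exp (- c * \<Pi>w n \<omega> powr (1/3) * \<epsilon> powr (2/3))) \<partial>M)"
proof (cases "\<forall>j<n + l. x j \<in> essential_states")
  case False
  then have "emeasure M (cyl x (n + l)) = 0" using null_cyl_of_inessential by auto
  then have "AE \<omega> in M. \<omega> \<notin> cyl x (n + l)" using cyl_in_G[of x "n + l"] by (intro AE_not_in) auto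
  then have "AE \<omega> in M. \<omega> \<notin> B" using B by (auto elim!: eventually_mono)
  then have "(\<integral>\<^sup>+\<omega>\<in>B. f \<omega> \<partial>M) = 0" for f :: "'a \<Rightarrow> ennreal"
    by (subst nn_integral_cong_AE[where v = "\<lambda>_. 0"]) (auto elim!: eventually_mono)
  then show ?thesis by simp
next
  case True
  have [measurable]: "B \<in> sets M" using B by auto
  have BM: "\<omega> \<in> space M" if "\<omega> \<in> B" for \<omega> using that sets.sets_into_space[of B M] by auto
  have c: "c > 0" and D: "D \<ge> 0" using ctrl by (auto simp: mgf_controlled_def)
  define P where "P = (\<Prod>j<n. m (x j))"
  have P: "\<Pi>w n \<omega> = P" if "\<omega> \<in> B" for \<omega>
    using that B Pi_on_cyl[of \<omega> x "n + l" n] by (auto simp: P_def)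
  have P1: "P \<ge> 1" unfolding P_def using True m1 by (intro prod_ge_1) (auto intro: less_imp_le)
  \<comment> \<open>Truncation level for \<open>Wn n\<close>, chosen so that the moment bound for
    \<open>Wn n > Y\<close> and the deviation bound both decay like
    \<open>exp (- c * Y)\<close>.\<close>
  define Y where "Y = P powr (1/3) * \<epsilon> powr (2/3)"
  have Y0: "Y > 0" using P1 \<open>\<epsilon> > 0\<close> by (simp add: Y_def)
  let ?C = "tail_const c D"
  have C0: "?C > 0" by (simp add: tail_const_def less_max_iff_disj)
  have rhs: "(\<integral>\<^sup>+\<omega>\<in>B. ennreal (?C * exp (- c * \<Pi>w n \<omega> powr (1/3) * \<epsilon> powr (2/3))) \<partial>M)
     = (\<integral>\<^sup>+\<omega>\<in>B. ennreal (?C * exp (- c * Y)) \<partial>M)"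
    by (intro nn_integral_cong) (auto simp: indicator_def P Y_def mult.assoc)
  show ?thesis
  proof (cases "Y \<le> 1")
    case True
    have "1 = exp c * exp (- c)" by (simp add: exp_add[symmetric])
    also have "\<dots> \<le> ?C * exp (- c * Y)"
      using True c C0 by (intro mult_mono) (auto simp: tail_const_def[of c D])
    finally have "1 \<le> ennreal (?C * exp (- c * Y))" by (simp add: ennreal_1[symmetric] del: ennreal_1)
    then show ?thesis unfolding rhs
      by (intro nn_integral_mono mult_right_mono) (auto simp: indicator_def)
  next
    case False
    define t where "t = c * P powr (-2/3) * \<epsilon> powr (-1/3)"
    have Y3: "P * \<epsilon>\<^sup>2 = Y ^ 3"
      using P1 \<open>\<epsilon> > 0\<close> by (simp add: Y_def power_mult_distrib powr_power)
    \<comment> \<open>Since \<open>t = c * (P^2 \<epsilon>) powr (-1/3)\<close>, this amounts to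
      \<open>t \<le> c\<close>. It follows from \<open>P \<epsilon>^2 \<ge> 1\<close>, a consequence
      of \<open>Y > 1\<close>, together with \<open>P \<ge> 1\<close>.\<close>
    have "1 \<le> P\<^sup>2 * \<epsilon>"
    proof -
      have "1 \<le> Y ^ 3" using False by (simp add: one_le_power)
      then have "1 \<le> P * \<epsilon>\<^sup>2" using Y3 by simp
      moreover have "P * \<epsilon>\<^sup>2 \<le> (P * \<epsilon>\<^sup>2) * P ^ 3" using P1 \<open>\<epsilon> > 0\<close> by simp
      ultimately have "1\<^sup>2 \<le> (P\<^sup>2 * \<epsilon>)\<^sup>2" by (simp add: power_mult_distrib power2_eq_square power3_eq_cube mult_ac)
      then show ?thesis using P1 \<open>\<epsilon> > 0\<close> by (subst (asm) power_mono_iff) auto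
    qed
    then have "1 \<le> (P\<^sup>2 * \<epsilon>) powr (1/3)" by (simp add: ge_one_powr_ge_zero)
    also have "\<dots> = P powr (2/3) * \<epsilon> powr (1/3)"
      using P1 \<open>\<epsilon> > 0\<close> powr_powr[of P 2 "1/3"] by (simp add: powr_mult)
    finally have "c \<le> c * (P powr (2/3) * \<epsilon> powr (1/3))" using c by simp
    then have tc: "t \<le> c"
      using P1 \<open>\<epsilon> > 0\<close> by (simp add: t_def powr_minus divide_simps mult_ac)
    have t0: "t > 0" using c P1 \<open>\<epsilon> > 0\<close> by (simp add: t_def)
    have tP\<epsilon>: "t * P * \<epsilon> = c * Y"
    proof -
      have "P powr (-2/3) * P = P powr (1/3)" "\<epsilon> powr (-1/3) * \<epsilon> = \<epsilon> powr (2/3)"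
        using P1 \<open>\<epsilon> > 0\<close> powr_add[of P "-2/3" 1] powr_add[of \<epsilon> "-1/3" 1] by auto
      then have "c * (P powr (-2/3) * P) * (\<epsilon> powr (-1/3) * \<epsilon>) = c * Y" by (simp add: Y_def)
      then show ?thesis by (simp add: t_def mult_ac)
    qed
    have t2: "t\<^sup>2 * (Y * P) = c\<^sup>2"
    proof -
      have "(t\<^sup>2 * (Y * P)) * (P * \<epsilon>\<^sup>2) = (t * P * \<epsilon>)\<^sup>2 * Y" by (simp add: power2_eq_square mult_ac)
      also have "\<dots> = c\<^sup>2 * Y ^ 3" unfolding tP\<epsilon> by (simp add: power2_eq_square power3_eq_cube mult_ac)
      finally have "(t\<^sup>2 * (Y * P)) * (P * \<epsilon>\<^sup>2) = c\<^sup>2 * (P * \<epsilon>\<^sup>2)" unfolding Y3 .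
      then show ?thesis using P1 \<open>\<epsilon> > 0\<close> by simp
    qed
    \<comment> \<open>Exponential majorant of a one-sided deviation on
      \<open>Z n \<le> Y * P\<close>: \<open>\<sigma>\<close> is 1 for upward and -1 for downward
      deviations, and \<open>exp (- c * Y)\<close> is the Chernoff factor.\<close>
    define U where "U \<sigma> \<omega> = ennreal (if real (Z n \<omega>) \<le> Y * P then exp (\<sigma> * t * (P * Wn (n + l) \<omega> - real (Z n \<omega>)) - c * Y) else 0)"
      for \<sigma> \<omega>
    have [measurable]: "U \<sigma> \<in> borel_measurable M" for \<sigma> unfolding U_def[abs_def] by measurable
    have U: "(\<integral>\<^sup>+\<omega>\<in>B. U \<sigma> \<omega> \<partial>M) \<le> (\<integral>\<^sup>+\<omega>\<in>B. ennreal (exp (D * c\<^sup>2) * exp (- c * Y)) \<partial>M)" if "\<bar>\<sigma>\<bar> = 1" for \<sigma>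
    proof -
      \<comment> \<open>Everything in \<open>U\<close> except the exponential of
        \<open>Wn (n + l)\<close> depends on \<open>Z n\<close> alone, truncation included, and
        forms the weight in \<open>mgf_on_cyl\<close>.\<close>
      define \<phi> where "\<phi> z = ennreal (if real z \<le> Y * P then exp (- \<sigma> * t * real z - c * Y) else 0)" for z
      have "(\<integral>\<^sup>+\<omega>\<in>B. U \<sigma> \<omega> \<partial>M)
         = (\<integral>\<^sup>+\<omega>\<in>B. \<phi> (Z n \<omega>) * ennreal (exp (\<sigma> * t * \<Pi>w n \<omega> * Wn (n + l) \<omega>)) \<partial>M)"
        by (intro nn_integral_cong)
          (auto simp: U_def \<phi>_def indicator_def P ennreal_mult[symmetric] exp_add[symmetric] algebra_simps)
      also have "\<dots> \<le> (\<integral>\<^sup>+\<omega>\<in>B. \<phi> (Z n \<omega>) * ennreal (exp ((\<sigma> * t + D * (\<sigma> * t)\<^sup>2) * real (Z n \<omega>))) \<partial>M)"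
        using that t0 tc by (intro mgf_on_cyl[OF ctrl _ B]) (simp add: abs_mult)
      also have "\<dots> \<le> (\<integral>\<^sup>+\<omega>\<in>B. ennreal (exp (D * c\<^sup>2) * exp (- c * Y)) \<partial>M)"
      proof (intro nn_integral_mono mult_right_mono)
        fix \<omega>
        show "\<phi> (Z n \<omega>) * ennreal (exp ((\<sigma> * t + D * (\<sigma> * t)\<^sup>2) * real (Z n \<omega>)))
          \<le> ennreal (exp (D * c\<^sup>2) * exp (- c * Y))"
        proof (cases "real (Z n \<omega>) \<le> Y * P")
          case True
          \<comment> \<open>The linear terms will cancel, and the truncation bounds the quadratic
            one by \<open>D * c^2\<close>.\<close>
          have "\<sigma>\<^sup>2 = 1" using that by (simp add: abs_square_eq_1)
          then have "D * (\<sigma> * t)\<^sup>2 * real (Z n \<omega>) \<le> D * t\<^sup>2 * (Y * P)"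
            using True D by (simp add: power_mult_distrib mult_left_mono)
          also have "\<dots> = D * c\<^sup>2" using t2 by (simp add: mult.assoc)
          finally have "- \<sigma> * t * real (Z n \<omega>) - c * Y + (\<sigma> * t + D * (\<sigma> * t)\<^sup>2) * real (Z n \<omega>) \<le> D * c\<^sup>2 + - c * Y"
            by (simp add: algebra_simps)
          then show ?thesis using True
            by (simp add: \<phi>_def ennreal_mult[symmetric] exp_add[symmetric])
        qed (simp add: \<phi>_def)
      qed auto
      finally show ?thesis .
    qed
    \<comment> \<open>Markov majorant for the event \<open>Wn n > Y\<close>.\<close>
    define V where "V \<omega> = ennreal (exp (c * Wn n \<omega>) * exp (- c * Y))" for \<omega>
    have [measurable]: "V \<in> borel_measurable M" unfolding V_def[abs_def] by measurable
    have V: "(\<integral>\<^sup>+\<omega>\<in>B. V \<omega> \<partial>M) \<le> (\<integral>\<^sup>+\<omega>\<in>B. ennreal (exp (c + D * c\<^sup>2) * exp (- c * Y)) \<partial>M)"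
    proof -
      have scale: "(\<integral>\<^sup>+\<omega>\<in>B. ennreal (g \<omega> * exp (- c * Y)) \<partial>M)
         = (\<integral>\<^sup>+\<omega>\<in>B. ennreal (g \<omega>) \<partial>M) * ennreal (exp (- c * Y))"
        if [measurable]: "g \<in> borel_measurable M" and "\<And>\<omega>. g \<omega> \<ge> 0" for g
        using that(2) by (subst nn_integral_multc[symmetric]) (auto simp: ennreal_mult mult_ac)
      show ?thesis unfolding V_def
        using exp_moment_le[OF ctrl B(1), of n] by (subst (1 2) scale) (auto intro: mult_right_mono)
    qed
    have "(\<integral>\<^sup>+\<omega>\<in>B. indicator {\<omega>. \<bar>Wn (n + l) \<omega> - Wn n \<omega>\<bar> > \<epsilon>} \<omega> \<partial>M)
       \<le> (\<integral>\<^sup>+\<omega>. V \<omega> * indicator B \<omega> + (U 1 \<omega> * indicator B \<omega> + U (-1) \<omega> * indicator B \<omega>) \<partial>M)"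
    proof (intro nn_integral_mono)
      fix \<omega> assume \<omega>: "\<omega> \<in> space M"
      \<comment> \<open>Union bound at a point: each way of exceeding \<open>\<epsilon>\<close>
        makes one of the three majorants at least 1.\<close>
      have "(1::ennreal) \<le> V \<omega> + (U 1 \<omega> + U (-1) \<omega>)" if wB: "\<omega> \<in> B" and gt: "\<bar>Wn (n + l) \<omega> - Wn n \<omega>\<bar> > \<epsilon>"
      proof -
        have Zn: "real (Z n \<omega>) = P * Wn n \<omega>"
          using P1 by (simp add: bp_W_def P[OF wB])
        consider "Wn n \<omega> > Y" | "Wn n \<omega> \<le> Y" "Wn (n + l) \<omega> - Wn n \<omega> > \<epsilon>" | "Wn n \<omega> \<le> Y" "Wn n \<omega> - Wn (n + l) \<omega> > \<epsilon>"
          using gt by linarith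
        then show ?thesis
        proof cases
          case 1
          then have "1 \<le> exp (c * Wn n \<omega>) * exp (- c * Y)"
            using c by (simp add: exp_add[symmetric])
          then have "1 \<le> V \<omega>" unfolding V_def by (simp add: ennreal_1[symmetric] del: ennreal_1)
          then show ?thesis by (simp add: add_increasing2)
        next
          case 2
          then have "real (Z n \<omega>) \<le> Y * P" using P1 by (simp add: Zn mult.commute)
          moreover have "c * Y \<le> t * P * (Wn (n + l) \<omega> - Wn n \<omega>)"
            unfolding tP\<epsilon>[symmetric] using 2 t0 P1 by (intro mult_left_mono) auto
          ultimately have "1 \<le> U 1 \<omega>"
            unfolding U_def by (simp add: Zn algebra_simps ennreal_1[symmetric] del: ennreal_1)
          then show ?thesis by (simp add: add_increasing add_increasing2)
        next
          case 3
          then have "real (Z n \<omega>) \<le> Y * P" using P1 by (simp add: Zn mult.commute)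
          moreover have "c * Y \<le> t * P * (Wn n \<omega> - Wn (n + l) \<omega>)"
            unfolding tP\<epsilon>[symmetric] using 3 t0 P1 by (intro mult_left_mono) auto
          ultimately have "1 \<le> U (-1) \<omega>"
            unfolding U_def by (simp add: Zn algebra_simps ennreal_1[symmetric] del: ennreal_1)
          then show ?thesis by (simp add: add_increasing add_increasing2)
        qed
      qed
      then show "indicator {\<omega>. \<bar>Wn (n + l) \<omega> - Wn n \<omega>\<bar> > \<epsilon>} \<omega> * indicator B \<omega>
        \<le> V \<omega> * indicator B \<omega> + (U 1 \<omega> * indicator B \<omega> + U (-1) \<omega> * indicator B \<omega>)"
        by (auto simp: indicator_def)
    qed
    also have "\<dots> = (\<integral>\<^sup>+\<omega>\<in>B. V \<omega> \<partial>M) + ((\<integral>\<^sup>+\<omega>\<in>B. U 1 \<omega> \<partial>M) + (\<integral>\<^sup>+\<omega>\<in>B. U (-1) \<omega> \<partial>M))"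
      by (simp add: nn_integral_add)
    also have "\<dots> \<le> (\<integral>\<^sup>+\<omega>\<in>B. ennreal (exp (c + D * c\<^sup>2) * exp (- c * Y)) \<partial>M)
        + ((\<integral>\<^sup>+\<omega>\<in>B. ennreal (exp (D * c\<^sup>2) * exp (- c * Y)) \<partial>M) + (\<integral>\<^sup>+\<omega>\<in>B. ennreal (exp (D * c\<^sup>2) * exp (- c * Y)) \<partial>M))"
      by (intro add_mono V U) auto
    also have "\<dots> = (\<integral>\<^sup>+\<omega>\<in>B. ennreal ((exp (c + D * c\<^sup>2) + 2 * exp (D * c\<^sup>2)) * exp (- c * Y)) \<partial>M)"
      by (subst nn_integral_add[symmetric], simp, simp)+
        (auto intro!: nn_integral_cong simp: indicator_def ennreal_plus[symmetric] algebra_simps simp del: ennreal_plus)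
    also have "\<dots> \<le> (\<integral>\<^sup>+\<omega>\<in>B. ennreal (?C * exp (- c * Y)) \<partial>M)"
      by (intro nn_integral_mono mult_right_mono ennreal_leI) (auto simp: tail_const_def)
    finally show ?thesis unfolding rhs .
  qed
qed

end

text \<open>Fatou's lemma in the shape that carries inequalities for finite generations over to
  \<open>W\<close> and later removes a truncation.\<close>

lemma nn_integral_le_liminf_bound:
  fixes u :: "nat \<Rightarrow> 'a \<Rightarrow> ennreal"
  assumes "\<And>l. u l \<in> borel_measurable M" and "AE \<omega> in M. f \<omega> \<le> liminf (\<lambda>l. u l \<omega>)"
    and "\<And>l. (\<integral>\<^sup>+\<omega>. u l \<omega> \<partial>M) \<le> K"
  shows "(\<integral>\<^sup>+\<omega>. f \<omega> \<partial>M) \<le> K"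
proof -
  have "(\<integral>\<^sup>+\<omega>. f \<omega> \<partial>M) \<le> (\<integral>\<^sup>+\<omega>. liminf (\<lambda>l. u l \<omega>) \<partial>M)"
    using assms(2) by (rule nn_integral_mono_AE)
  also have "\<dots> \<le> liminf (\<lambda>l. \<integral>\<^sup>+\<omega>. u l \<omega> \<partial>M)"
    using assms(1) by (rule nn_integral_liminf)
  also have "\<dots> \<le> limsup (\<lambda>l. \<integral>\<^sup>+\<omega>. u l \<omega> \<partial>M)"
    by (rule Liminf_le_Limsup) simp
  also have "\<dots> \<le> K"
    using assms(3) by (intro Limsup_bounded) auto
  finally show ?thesis .
qed

section \<open>Passage to the limit and the tail bounds\<close>

context finite_env_branching
begin

lemma space_in_G: "space M \<in> sets G"
  using sets.top[of G] unfolding space_G .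

text \<open>The set where the bound fails is itself an environment event. Testing the integral
  inequality there forces the excess of the quenched probability over \<open>h\<close> to vanish
  almost everywhere.\<close>

lemma quenched_prob_le:
  assumes A: "A \<in> sets M" and hG: "h \<in> borel_measurable G" and h: "\<And>\<omega>. 0 \<le> h \<omega>" "integrable M h"
    and le: "\<And>B. B \<in> sets G \<Longrightarrow> (\<integral>\<^sup>+\<omega>\<in>B. indicator A \<omega> \<partial>M) \<le> (\<integral>\<^sup>+\<omega>\<in>B. ennreal (h \<omega>) \<partial>M)"
  shows "AE \<omega> in M. quenched_prob M E \<xi> A \<omega> \<le> h \<omega>"
proof -
  let ?q = "quenched_prob M E \<xi> A"
  define B where "B = {\<omega>\<in>space M. ?q \<omega> > h \<omega>}"
  have "{\<omega>\<in>space G. h \<omega> < ?q \<omega>} \<in> sets G"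
    by (rule borel_measurable_less[OF hG quenched_prob_measurable])
  then have B: "B \<in> sets G" by (simp add: B_def)
  then have [measurable]: "B \<in> sets M" by auto
  have qi: "integrable M ?q"
    unfolding quenched_prob_def using A
    by (intro G.real_cond_exp_int) (auto simp: integrable_real_indicator less_top[symmetric])
  have int: "integrable M (\<lambda>\<omega>. indicator B \<omega> * ?q \<omega>)" "integrable M (\<lambda>\<omega>. indicator B \<omega> * h \<omega>)"
    using integrable_real_mult_indicator[OF _ qi, of B] integrable_real_mult_indicator[OF _ h(2), of B]
    by (simp_all add: mult.commute)
  have "ennreal (measure M (B \<inter> A)) = (\<integral>\<^sup>+\<omega>\<in>B. indicator A \<omega> \<partial>M)"
  proof -
    have "(\<integral>\<^sup>+\<omega>\<in>B. indicator A \<omega> \<partial>M) = (\<integral>\<^sup>+\<omega>. indicator (B \<inter> A) \<omega> \<partial>M)"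
      by (intro nn_integral_cong) (auto simp: indicator_def)
    then show ?thesis using A by (simp add: emeasure_eq_measure)
  qed
  also have "\<dots> \<le> (\<integral>\<^sup>+\<omega>\<in>B. ennreal (h \<omega>) \<partial>M)" by (rule le[OF B])
  also have "\<dots> = (\<integral>\<^sup>+\<omega>. ennreal (indicator B \<omega> * h \<omega>) \<partial>M)"
    by (intro nn_integral_cong) (auto simp: indicator_def)
  also have "\<dots> = ennreal (\<integral>\<omega>. indicator B \<omega> * h \<omega> \<partial>M)"
    using int(2) h(1) by (intro nn_integral_eq_integral) auto
  finally have "measure M (B \<inter> A) \<le> (\<integral>\<omega>. indicator B \<omega> * h \<omega> \<partial>M)"
    using h(1) by (subst (asm) ennreal_le_iff) (auto intro!: integral_nonneg_AE)
  moreover have "measure M (B \<inter> A) = (\<integral>\<omega>. indicator B \<omega> * ?q \<omega> \<partial>M)"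
    using quenched_integral[OF A B] by (simp add: set_lebesgue_integral_def)
  ultimately have "(\<integral>\<omega>. indicator B \<omega> * ?q \<omega> - indicator B \<omega> * h \<omega> \<partial>M) \<le> 0"
    using int by simp
  moreover have nn: "0 \<le> indicator B \<omega> * ?q \<omega> - indicator B \<omega> * h \<omega>" for \<omega>
    by (auto simp: indicator_def B_def)
  ultimately have "(\<integral>\<omega>. indicator B \<omega> * ?q \<omega> - indicator B \<omega> * h \<omega> \<partial>M) = 0"
    by (intro antisym integral_nonneg_AE) auto
  then have "AE \<omega> in M. indicator B \<omega> * ?q \<omega> - indicator B \<omega> * h \<omega> = 0"
    using int nn by (subst (asm) integral_nonneg_eq_0_iff_AE) auto
  then show ?thesis using AE_space
    by eventually_elim (auto simp: indicator_def B_def not_less split: if_splits)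
qed

lemma tail_finite_generation:
  assumes m1: "\<And>e. e \<in> essential_states \<Longrightarrow> m e > 1"
    and ctrl: "mgf_controlled c D" and B: "B \<in> sets G" and "\<epsilon> > 0"
  shows "(\<integral>\<^sup>+\<omega>\<in>B. indicator {\<omega>. \<bar>Wn (n + l) \<omega> - Wn n \<omega>\<bar> > \<epsilon>} \<omega> \<partial>M)
    \<le> (\<integral>\<^sup>+\<omega>\<in>B. ennreal (tail_const c D * exp (- c * \<Pi>w n \<omega> powr (1/3) * \<epsilon> powr (2/3))) \<partial>M)"
proof (rule set_nn_integral_le_by_cyl[OF B, where N = "n + l"])
  show "(\<integral>\<^sup>+\<omega>\<in>B \<inter> cyl x (n + l). indicator {\<omega>. \<bar>Wn (n + l) \<omega> - Wn n \<omega>\<bar> > \<epsilon>} \<omega> \<partial>M)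
    \<le> (\<integral>\<^sup>+\<omega>\<in>B \<inter> cyl x (n + l). ennreal (tail_const c D * exp (- c * \<Pi>w n \<omega> powr (1/3) * \<epsilon> powr (2/3))) \<partial>M)" for x
    using B cyl_in_G[of x "n + l"] by (intro tail_on_cyl[OF m1 ctrl _ _ \<open>\<epsilon> > 0\<close>]) auto
qed measurable

text \<open>The strict inequality matters: if \<open>W\<close> deviates by more than
  \<open>\<epsilon>\<close>, so do all late \<open>Wn (n + l)\<close>, and Fatou's lemma applies to
  the indicators.\<close>

lemma tail_limit:
  assumes m1: "\<And>e. e \<in> essential_states \<Longrightarrow> m e > 1"
    and ctrl: "mgf_controlled c D" and B: "B \<in> sets G" and "\<epsilon> > 0"
    and lim: "AE \<omega> in M. (\<lambda>n. Wn n \<omega>) \<longlonglongrightarrow> W \<omega>"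
  shows "(\<integral>\<^sup>+\<omega>\<in>B. indicator {\<omega>\<in>space M. \<bar>W \<omega> - Wn n \<omega>\<bar> > \<epsilon>} \<omega> \<partial>M)
    \<le> (\<integral>\<^sup>+\<omega>\<in>B. ennreal (tail_const c D * exp (- c * \<Pi>w n \<omega> powr (1/3) * \<epsilon> powr (2/3))) \<partial>M)"
proof (rule nn_integral_le_liminf_bound)
  have [measurable]: "B \<in> sets M" using B by auto
  show "(\<lambda>\<omega>. indicator {\<omega>. \<bar>Wn (n + l) \<omega> - Wn n \<omega>\<bar> > \<epsilon>} \<omega> * indicator B \<omega> :: ennreal) \<in> borel_measurable M" for l
    by measurable
  show "AE \<omega> in M. indicator {\<omega>\<in>space M. \<bar>W \<omega> - Wn n \<omega>\<bar> > \<epsilon>} \<omega> * indicator B \<omega>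
    \<le> liminf (\<lambda>l. indicator {\<omega>. \<bar>Wn (n + l) \<omega> - Wn n \<omega>\<bar> > \<epsilon>} \<omega> * indicator B \<omega> :: ennreal)"
    using lim
  proof eventually_elim
    case (elim \<omega>)
    show ?case
    proof (cases "\<omega> \<in> B \<and> \<bar>W \<omega> - Wn n \<omega>\<bar> > \<epsilon>")
      case True
      have "(\<lambda>l. Wn (n + l) \<omega>) \<longlonglongrightarrow> W \<omega>"
        using LIMSEQ_ignore_initial_segment[OF elim, of n] by (simp add: add.commute)
      then have "(\<lambda>l. \<bar>Wn (n + l) \<omega> - Wn n \<omega>\<bar>) \<longlonglongrightarrow> \<bar>W \<omega> - Wn n \<omega>\<bar>"
        by (intro tendsto_intros)
      then have "eventually (\<lambda>l. \<bar>Wn (n + l) \<omega> - Wn n \<omega>\<bar> > \<epsilon>) sequentially"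
        using True by (intro order_tendstoD) auto
      then have "1 \<le> liminf (\<lambda>l. indicator {\<omega>. \<bar>Wn (n + l) \<omega> - Wn n \<omega>\<bar> > \<epsilon>} \<omega> * indicator B \<omega> :: ennreal)"
        using True by (intro Liminf_bounded) (auto elim!: eventually_mono)
      then show ?thesis by (auto simp: indicator_def intro: order_trans)
    qed (auto simp: indicator_def)
  qed
qed (rule tail_finite_generation[OF m1 ctrl B \<open>\<epsilon> > 0\<close>])

text \<open>The bound in \<open>exp_moment_le\<close> is uniform in the generation, so Fatou's lemma
  keeps the exponent \<open>c\<close>.\<close>

lemma exp_moment_limit:
  assumes ctrl: "mgf_controlled c D"
    and lim: "AE \<omega> in M. (\<lambda>n. Wn n \<omega>) \<longlonglongrightarrow> W \<omega>"
  shows "has_exp_moment M W c"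
proof -
  have "(\<integral>\<^sup>+\<omega>. ennreal (exp (c * W \<omega>)) \<partial>M) \<le> ennreal (exp (c + D * c\<^sup>2))"
  proof (rule nn_integral_le_liminf_bound)
    show "(\<lambda>\<omega>. ennreal (exp (c * Wn l \<omega>))) \<in> borel_measurable M" for l by measurable
    show "(\<integral>\<^sup>+\<omega>. ennreal (exp (c * Wn l \<omega>)) \<partial>M) \<le> ennreal (exp (c + D * c\<^sup>2))" for l
    proof -
      have "(\<integral>\<^sup>+\<omega>. ennreal (exp (c * Wn l \<omega>)) \<partial>M) = (\<integral>\<^sup>+\<omega>\<in>space M. ennreal (exp (c * Wn l \<omega>)) \<partial>M)"
        by (intro nn_integral_cong) auto
      also have "\<dots> \<le> (\<integral>\<^sup>+\<omega>\<in>space M. ennreal (exp (c + D * c\<^sup>2)) \<partial>M)"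
        by (rule exp_moment_le[OF ctrl space_in_G])
      also have "\<dots> = ennreal (exp (c + D * c\<^sup>2))"
        by (subst nn_integral_cmult_indicator) (auto simp: emeasure_space_1)
      finally show ?thesis .
    qed
    show "AE \<omega> in M. ennreal (exp (c * W \<omega>)) \<le> liminf (\<lambda>l. ennreal (exp (c * Wn l \<omega>)))"
      using lim
    proof eventually_elim
      case (elim \<omega>)
      then have "(\<lambda>l. ennreal (exp (c * Wn l \<omega>))) \<longlonglongrightarrow> ennreal (exp (c * W \<omega>))"
        by (intro tendsto_intros)
      from lim_imp_Liminf[OF sequentially_bot this] show ?case by simp
    qed
  qed
  also have "\<dots> < \<infinity>" by simp
  finally show ?thesis by (simp add: has_exp_moment_def)
qed

lemma Pi_ge_power: "AE \<omega> in M. essinf M (env_mean \<xi> p 0) ^ n \<le> \<Pi>w n \<omega>"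
  if "essinf M (env_mean \<xi> p 0) \<ge> 0"
  using AE_essential_states
proof eventually_elim
  case (elim \<omega>)
  have "essinf M (env_mean \<xi> p 0) \<le> env_mean \<xi> p j \<omega>" for j
    unfolding essinf_eq_Min using elim finite_essential_states by (simp add: env_mean_def)
  then have "(\<Prod>j<n. essinf M (env_mean \<xi> p 0)) \<le> \<Pi>w n \<omega>"
    unfolding bp_Pi_def using that by (intro prod_mono) auto
  then show ?case by simp
qed

text \<open>The quenched bound comes from \<open>tail_limit\<close> on all environment events. For
  the annealed one the event is the whole space, and \<open>\<Pi>w n\<close> is at least the
  \<open>n\<close>-th power of the essential infimum.\<close>

lemma concentration:
  assumes m1: "\<And>e. e \<in> essential_states \<Longrightarrow> m e > 1"
    and ctrl: "mgf_controlled c D" and "\<epsilon> > 0"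
    and Wm [measurable]: "W \<in> borel_measurable M"
    and lim: "AE \<omega> in M. (\<lambda>n. Wn n \<omega>) \<longlonglongrightarrow> W \<omega>"
  shows "AE \<omega> in M. quenched_prob M E \<xi> {\<omega>'\<in>space M. \<bar>W \<omega>' - Wn n \<omega>'\<bar> > \<epsilon>} \<omega>
      \<le> tail_const c D * exp (- c * \<Pi>w n \<omega> powr (1/3) * \<epsilon> powr (2/3))" (is ?quenched)
    and "measure M {\<omega>\<in>space M. \<bar>W \<omega> - Wn n \<omega>\<bar> > \<epsilon>}
      \<le> tail_const c D * exp (- c * essinf M (env_mean \<xi> p 0) powr (real n / 3) * \<epsilon> powr (2/3))" (is ?annealed)
proof -
  let ?A = "{\<omega>\<in>space M. \<bar>W \<omega> - Wn n \<omega>\<bar> > \<epsilon>}"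
  let ?h = "\<lambda>\<omega>. tail_const c D * exp (- c * \<Pi>w n \<omega> powr (1/3) * \<epsilon> powr (2/3))"
  have C: "tail_const c D > 0" by (simp add: tail_const_def less_max_iff_disj)
  have c: "c > 0" using ctrl by (simp add: mgf_controlled_def)
  note [measurable] = Pi_measurable_G
  note le = tail_limit[OF m1 ctrl _ \<open>\<epsilon> > 0\<close> lim]
  show ?quenched
  proof (rule quenched_prob_le)
    show "?h \<in> borel_measurable G" by measurable
    show "integrable M ?h"
    proof (rule integrable_const_bound[where B = "tail_const c D"])
      show "AE \<omega> in M. norm (?h \<omega>) \<le> tail_const c D"
        using C c by (intro AE_I2) (simp add: mult_left_le)
    qed measurable
  qed (use C le in auto)
  let ?k = "tail_const c D * exp (- c * essinf M (env_mean \<xi> p 0) powr (real n / 3) * \<epsilon> powr (2/3))"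
  have mu: "essinf M (env_mean \<xi> p 0) > 1"
    unfolding essinf_eq_Min using m1 finite_essential_states essential_states_nonempty by simp
  have "ennreal (measure M ?A) = (\<integral>\<^sup>+\<omega>\<in>space M. indicator ?A \<omega> \<partial>M)"
  proof -
    have "(\<integral>\<^sup>+\<omega>\<in>space M. indicator ?A \<omega> \<partial>M) = (\<integral>\<^sup>+\<omega>. indicator ?A \<omega> \<partial>M)"
      by (intro nn_integral_cong) auto
    then show ?thesis by (simp add: emeasure_eq_measure)
  qed
  also have "\<dots> \<le> (\<integral>\<^sup>+\<omega>\<in>space M. ennreal (?h \<omega>) \<partial>M)"
    by (rule le[OF _ space_in_G])
  also have "\<dots> \<le> (\<integral>\<^sup>+\<omega>\<in>space M. ennreal ?k \<partial>M)"
  proof (rule nn_integral_mono_AE)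
    show "AE \<omega> in M. ennreal (?h \<omega>) * indicator (space M) \<omega> \<le> ennreal ?k * indicator (space M) \<omega>"
      using Pi_ge_power[of n, OF less_imp_le[OF less_trans[OF zero_less_one mu]]]
    proof eventually_elim
      case (elim \<omega>)
      have "essinf M (env_mean \<xi> p 0) powr (real n / 3) = (essinf M (env_mean \<xi> p 0) ^ n) powr (1/3)"
        using mu powr_powr[of "essinf M (env_mean \<xi> p 0)" "real n" "1/3"] by (simp add: powr_realpow)
      also have "\<dots> \<le> \<Pi>w n \<omega> powr (1/3)"
        using elim mu by (intro powr_mono2) auto
      finally have "c * (essinf M (env_mean \<xi> p 0) powr (real n / 3) * \<epsilon> powr (2/3))
          \<le> c * (\<Pi>w n \<omega> powr (1/3) * \<epsilon> powr (2/3))"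
        using c by (intro mult_left_mono mult_right_mono) auto
      then have "?h \<omega> \<le> ?k" using C by (intro mult_left_mono) (auto simp: mult.assoc)
      then show ?case by (intro mult_right_mono ennreal_leI) auto
    qed
  qed
  also have "\<dots> = ennreal ?k"
    by (subst nn_integral_cmult_indicator) (auto simp: emeasure_space_1)
  finally show ?annealed using C by (subst (asm) ennreal_le_iff) auto
qed

end

section \<open>Laplace transforms and degenerate environments\<close>

lemma pgf_one [simp]: "pgf q 1 = 1"
  by (simp add: pgf_def)

lemma pgf_le_1: "s \<le> 1 \<Longrightarrow> pgf q s \<le> 1"
  using pgf_mono[of s 1 q] by simp

lemma pgf_comp_le_1: "s \<le> 1 \<Longrightarrow> pgf_comp q k n s \<le> 1"
  by (induction n arbitrary: k) (auto intro: pgf_le_1)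

text \<open>Some \<open>k \<ge> 1\<close> is charged because the mean is positive; a vanishing
  integral of \<open>1 - s ^ j\<close> then forces \<open>s ^ k = 1\<close>. This carries degeneracy
  from an environment to its shift.\<close>

lemma pgf_eq_1D:
  assumes "mean_offspring q > 0" "pgf q s = 1" "s \<le> 1"
  shows "s = 1"
proof -
  have "\<exists>k\<in>set_pmf q. k \<ge> 1"
  proof (rule ccontr)
    assume "\<not> ?thesis"
    then have "pmf q k = 0" if "k \<ge> 1" for k using that by (auto simp: set_pmf_iff)
    then have "real k * pmf q k = 0" for k by (cases "k = 0") auto
    then have "(\<lambda>k. real k * pmf q k) = (\<lambda>_. 0)" by (intro ext)
    then have "mean_offspring q = 0" by (simp add: mean_offspring_def)
    then show False using assms(1) by simp
  qed
  then obtain k where k: "k \<in> set_pmf q" "k \<ge> 1" by auto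
  have "(\<integral>\<^sup>+j. 1 - s ^ j \<partial>measure_pmf q) = 1 - pgf q s"
    using assms unfolding pgf_def by (subst nn_integral_diff) (auto intro!: power_le_one)
  then have "(\<integral>\<^sup>+j. 1 - s ^ j \<partial>measure_pmf q) = 0" using assms(2) by simp
  then have "AE j in measure_pmf q. 1 - s ^ j = 0" by (subst (asm) nn_integral_0_iff_AE) auto
  then have "1 \<le> s ^ k" using k by (auto simp: AE_measure_pmf_iff diff_eq_0_iff_ennreal)
  also have "s ^ k \<le> s ^ 1" using k(2) assms(3) by (intro power_decreasing) auto
  finally show ?thesis using assms(3) by simp
qed

text \<open>Monotone convergence; finiteness of the supremum excludes zero times infinity, where
  multiplication in \<open>ennreal\<close> is discontinuous.\<close>

lemma pgf_SUP:
  assumes "incseq s" "\<And>n. s n \<le> 1"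
  shows "pgf q (SUP n. s n) = (SUP n. pgf q (s n))"
proof -
  have le1: "(SUP n. s n) \<le> 1" using assms(2) by (intro SUP_least)
  have not_top: "x \<noteq> \<infinity>" if "x \<le> 1" for x :: ennreal using that by (auto simp: top_unique)
  have fin: "(SUP n. s n) \<noteq> \<infinity>" "(SUP n. s n) ^ k \<noteq> \<infinity>" for k
    using le1 by (auto intro!: not_top power_le_one simp del: infinity_ennreal_def)
  have "(SUP n. s n) ^ k = (SUP n. s n ^ k)" for k
  proof (rule LIMSEQ_unique)
    show "(\<lambda>n. s n ^ k) \<longlonglongrightarrow> (SUP n. s n) ^ k"
    proof (induction k)
      case (Suc k)
      show ?case unfolding power_Suc using fin
        by (intro tendsto_mult_ennreal Suc LIMSEQ_SUP assms(1)) auto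
    qed simp
    show "(\<lambda>n. s n ^ k) \<longlonglongrightarrow> (SUP n. s n ^ k)"
      using assms(1) by (intro LIMSEQ_SUP) (auto simp: incseq_def intro: power_mono)
  qed
  then have "pgf q (SUP n. s n) = (\<integral>\<^sup>+k. (SUP n. s n ^ k) \<partial>measure_pmf q)"
    by (simp add: pgf_def)
  also have "\<dots> = (SUP n. pgf q (s n))"
    unfolding pgf_def using assms(1)
    by (intro nn_integral_monotone_convergence_SUP) (auto simp: incseq_def le_fun_def intro: power_mono)
  finally show ?thesis .
qed

text \<open>Jensen's inequality, from the tangent of the convex function
  \<open>exp (- u x / m)\<close> at the mean \<open>x = m\<close>.\<close>

lemma pgf_exp_ge:
  assumes "summable (\<lambda>i. real i * pmf q i)" "mean_offspring q > 0" "u \<ge> 0"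
  shows "ennreal (exp (- u)) \<le> pgf q (ennreal (exp (- u / mean_offspring q)))"
proof -
  let ?m = "mean_offspring q"
  note mean = mean_offspring_integral[OF assms(1)]
  have int: "integrable (measure_pmf q) (\<lambda>k. exp (- u / ?m * real k))"
    using assms by (intro measure_pmf.integrable_const_bound[where B = 1]) auto
  have "exp (- u) = (\<integral>k. exp (- u) * (1 + u - u / ?m * real k) \<partial>measure_pmf q)"
    using mean assms(2) by simp
  also have "\<dots> \<le> (\<integral>k. exp (- u / ?m * real k) \<partial>measure_pmf q)"
  proof (rule integral_mono[OF _ int])
    fix k :: nat
    have "exp (- u) * (1 + (u - u / ?m * real k)) \<le> exp (- u) * exp (u - u / ?m * real k)"
      by (intro mult_left_mono exp_ge_add_one_self) auto
    then show "exp (- u) * (1 + u - u / ?m * real k) \<le> exp (- u / ?m * real k)"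
      by (simp add: exp_add[symmetric] add_diff_eq)
  qed (use mean(1) in simp)
  finally have "ennreal (exp (- u)) \<le> ennreal (\<integral>k. exp (- u / ?m * real k) \<partial>measure_pmf q)"
    by (rule ennreal_leI)
  also have "\<dots> = (\<integral>\<^sup>+k. ennreal (exp (- u / ?m * real k)) \<partial>measure_pmf q)"
    using int by (intro nn_integral_eq_integral[symmetric]) auto
  also have "\<dots> = pgf q (ennreal (exp (- u / ?m)))"
    unfolding pgf_def by (intro nn_integral_cong) (simp add: ennreal_power exp_of_nat_mult[symmetric] mult.commute)
  finally show ?thesis .
qed

context finite_env_branching
begin

text \<open>The Laplace transform at \<open>t\<close> of the normalised population at time \<open>k + n\<close> of a single
  ancestor living at time \<open>k\<close> in the fixed environment \<open>y\<close>.\<close>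

definition lap :: "(nat \<Rightarrow> 'e) \<Rightarrow> nat \<Rightarrow> nat \<Rightarrow> real \<Rightarrow> ennreal" where
  "lap y k n t = pgf_comp (p \<circ> y) k n (ennreal (exp (- t / (\<Prod>j=k..<k + n. m (y j)))))"

text \<open>For \<open>t \<ge> 0\<close> the supremum is a limit by \<open>lap_incseq\<close>: the
  Laplace transform of the limiting population in environment \<open>y\<close>. It is defined
  without \<open>W\<close>, hence for every environment and without exceptional sets.\<close>

definition lap_lim :: "(nat \<Rightarrow> 'e) \<Rightarrow> real \<Rightarrow> ennreal" where
  "lap_lim y t = (SUP n. lap y 0 n t)"

text \<open>Integer arguments suffice by monotonicity and keep the set measurable.\<close>

definition degenerate_envs :: "(nat \<Rightarrow> 'e) set" where
  "degenerate_envs = {y \<in> space (env_space E). \<forall>i::nat. lap_lim y (real i) = 1}"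

lemma space_env: "y \<in> space (env_space E) \<longleftrightarrow> (\<forall>j. y j \<in> S)"
  by (auto simp: env_space_def space_PiM)

lemma prod_mean_pos: "(\<And>j. y j \<in> S) \<Longrightarrow> (\<Prod>j\<in>J. m (y j)) > 0"
  using mean_positive by (intro prod_pos) auto

lemma lap_Suc: "lap y k (Suc n) t = pgf (p (y k)) (lap y (Suc k) n (t / m (y k)))"
proof -
  have "(\<Prod>j=k..<k + Suc n. m (y j)) = m (y k) * (\<Prod>j=Suc k..<Suc k + n. m (y j))"
    by (subst prod.atLeast_Suc_lessThan) auto
  then show ?thesis unfolding lap_def by simp
qed

lemma lap_shift: "lap (env_shift y) k n t = lap y (Suc k) n t"
proof (induction n arbitrary: k t)
  case 0
  show ?case by (simp add: lap_def)
next
  case (Suc n)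
  then show ?case by (simp add: lap_Suc env_shift_def)
qed

lemma lap_le_1:
  assumes "\<And>j. y j \<in> S" "t \<ge> 0"
  shows "lap y k n t \<le> 1"
  unfolding lap_def using assms prod_mean_pos[of y "{k..<k + n}"]
  by (intro pgf_comp_le_1) (simp add: ennreal_1[symmetric] del: ennreal_1)

lemma lap_antimono:
  assumes "\<And>j. y j \<in> S" "t \<le> t'"
  shows "lap y k n t' \<le> lap y k n t"
  unfolding lap_def using assms prod_mean_pos[of y "{k..<k + n}"]
  by (intro pgf_comp_mono ennreal_leI) (simp add: divide_right_mono)

text \<open>Jensen's inequality in the innermost generation; it reflects that the normalised
  populations form a martingale and that \<open>exp (- t x)\<close> is convex in
  \<open>x\<close>.\<close>

lemma lap_incseq:
  assumes y: "\<And>j. y j \<in> S" and "t \<ge> 0"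
  shows "incseq (\<lambda>n. lap y k n t)"
proof (rule incseq_SucI)
  fix n
  let ?P = "\<Prod>j=k..<k + n. m (y j)"
  have P: "?P > 0" by (rule prod_mean_pos[OF y])
  have "ennreal (exp (- (t / ?P))) \<le> pgf (p (y (k + n))) (ennreal (exp (- (t / ?P) / m (y (k + n)))))"
    using y P \<open>t \<ge> 0\<close> by (intro pgf_exp_ge mean_finite mean_positive) (auto intro: divide_nonneg_pos)
  then have "pgf_comp (p \<circ> y) k n (ennreal (exp (- t / ?P)))
      \<le> pgf_comp (p \<circ> y) k n (pgf (p (y (k + n))) (ennreal (exp (- t / (?P * m (y (k + n)))))))"
    by (intro pgf_comp_mono) simp
  then show "lap y k n t \<le> lap y k (Suc n) t"
    unfolding lap_def pgf_comp_Suc_last by simp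
qed

lemma lap_lim_le_1: "y \<in> space (env_space E) \<Longrightarrow> t \<ge> 0 \<Longrightarrow> lap_lim y t \<le> 1"
  unfolding lap_lim_def space_env by (intro SUP_least lap_le_1) auto

lemma lap_lim_antimono: "y \<in> space (env_space E) \<Longrightarrow> t \<le> t' \<Longrightarrow> lap_lim y t' \<le> lap_lim y t"
  unfolding lap_lim_def space_env by (intro SUP_mono) (auto intro!: lap_antimono)

text \<open>The functional equation of the limit transform, from the first reproduction of the
  ancestor and monotone limits.\<close>

lemma lap_lim_shift:
  assumes y: "y \<in> space (env_space E)" and "t \<ge> 0"
  shows "lap_lim y t = pgf (p (y 0)) (lap_lim (env_shift y) (t / m (y 0)))"
proof -
  have yS: "y j \<in> S" for j using y by (simp add: space_env)
  then have sS: "env_shift y j \<in> S" for j by (simp add: env_shift_def)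
  have t': "t / m (y 0) \<ge> 0" using mean_positive[of "y 0"] yS \<open>t \<ge> 0\<close> by simp
  have "lap y 0 n t \<le> lap y 0 (Suc n) t" for n
    by (rule incseq_SucD[OF lap_incseq[OF yS \<open>t \<ge> 0\<close>]])
  then have "lap_lim y t = (SUP n. lap y 0 (Suc n) t)"
    unfolding lap_lim_def by (intro antisym SUP_mono) auto
  also have "\<dots> = (SUP n. pgf (p (y 0)) (lap (env_shift y) 0 n (t / m (y 0))))"
    by (simp add: lap_Suc lap_shift)
  also have "\<dots> = pgf (p (y 0)) (lap_lim (env_shift y) (t / m (y 0)))"
    unfolding lap_lim_def
    by (rule pgf_SUP[symmetric]) (auto intro!: lap_incseq lap_le_1 sS t')
  finally show ?thesis .
qed

text \<open>By the functional equation, degeneracy of the shift passes through the generating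
  function, which maps 1 to 1; the converse uses \<open>pgf_eq_1D\<close>. Rescaling by the mean
  leaves the integers, so arguments are rounded up and monotonicity in \<open>t\<close> is used. The
  equivalence is pointwise because \<open>ergodic\<close> speaks of exactly invariant sets.\<close>

lemma degenerate_envs_shift:
  assumes y: "y \<in> space (env_space E)"
  shows "env_shift y \<in> degenerate_envs \<longleftrightarrow> y \<in> degenerate_envs"
proof -
  have sy: "env_shift y \<in> space (env_space E)" using y by (simp add: space_env env_shift_def)
  have m0: "m (y 0) > 0" using y mean_positive by (simp add: space_env)
  show ?thesis
  proof
    assume *: "env_shift y \<in> degenerate_envs"
    have "lap_lim y (real i) = 1" for i :: nat
    proof -
      obtain j :: nat where j: "real i / m (y 0) \<le> real j" using real_arch_simple by blast
      have "1 = lap_lim (env_shift y) (real j)" using * by (simp add: degenerate_envs_def)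
      also have "\<dots> \<le> lap_lim (env_shift y) (real i / m (y 0))" by (rule lap_lim_antimono[OF sy j])
      finally have "lap_lim (env_shift y) (real i / m (y 0)) = 1"
        using lap_lim_le_1[OF sy, of "real i / m (y 0)"] m0 by (auto intro: antisym)
      then show ?thesis using lap_lim_shift[OF y, of "real i"] by simp
    qed
    then show "y \<in> degenerate_envs" using y by (simp add: degenerate_envs_def)
  next
    assume *: "y \<in> degenerate_envs"
    have "lap_lim (env_shift y) (real i) = 1" for i :: nat
    proof -
      obtain j :: nat where j: "real i * m (y 0) \<le> real j" using real_arch_simple by blast
      have "pgf (p (y 0)) (lap_lim (env_shift y) (real j / m (y 0))) = 1"
        using * lap_lim_shift[OF y, of "real j"] by (simp add: degenerate_envs_def)
      then have "1 = lap_lim (env_shift y) (real j / m (y 0))"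
        using m0 lap_lim_le_1[OF sy, of "real j / m (y 0)"] by (intro pgf_eq_1D[symmetric]) auto
      also have "\<dots> \<le> lap_lim (env_shift y) (real i)"
        using j m0 by (intro lap_lim_antimono[OF sy]) (simp add: pos_le_divide_eq)
      finally show ?thesis using lap_lim_le_1[OF sy, of "real i"] by (auto intro: antisym)
    qed
    then show "env_shift y \<in> degenerate_envs" using sy by (simp add: degenerate_envs_def)
  qed
qed

section \<open>Measurability and the zero-one law for degenerate environments\<close>

lemma borel_measurable_finite_coords:
  fixes f :: "(nat \<Rightarrow> 'e) \<Rightarrow> ennreal"
  assumes f: "\<And>y y'. (\<And>j. j < N \<Longrightarrow> y j = y' j) \<Longrightarrow> f y = f y'"
  shows "f \<in> borel_measurable (env_space E)"
proof -
  define I where "I = PiE {..<N} (\<lambda>_. S)"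
  have fin: "finite I" unfolding I_def by (intro finite_PiE finite_S) auto
  define C where "C x = {y \<in> space (env_space E). \<forall>j\<in>{..<N}. y j = x j}" for x
  have comp: "(\<lambda>y. y j) \<in> measurable (env_space E) (count_space S)" for j
    unfolding env_space_def E_eq by (rule measurable_component_singleton) simp
  have [measurable]: "C x \<in> sets (env_space E)" for x
    unfolding C_def
  proof (rule sets.sets_Collect_finite_All)
    fix j
    have "(\<lambda>y. y j) -` ({x j} \<inter> S) \<inter> space (env_space E) \<in> sets (env_space E)"
      by (rule measurable_sets[OF comp]) simp
    also have "(\<lambda>y. y j) -` ({x j} \<inter> S) \<inter> space (env_space E) = {y \<in> space (env_space E). y j = x j}"
      by (auto simp: space_env)
    finally show "{y \<in> space (env_space E). y j = x j} \<in> sets (env_space E)" .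
  qed simp
  \<comment> \<open>With finitely many prefixes, \<open>f\<close> is a finite combination of
    indicators of cylinders.\<close>
  have "(\<lambda>y. \<Sum>x\<in>I. f x * indicator (C x) y) \<in> borel_measurable (env_space E)" by measurable
  also have "?this \<longleftrightarrow> ?thesis"
  proof (rule measurable_cong)
    fix y assume y: "y \<in> space (env_space E)"
    define z where "z = restrict y {..<N}"
    have z: "z \<in> I" using y by (auto simp: I_def z_def space_env)
    have "y \<in> C x \<longleftrightarrow> x = z" if "x \<in> I" for x
      using that y by (auto simp: C_def z_def I_def PiE_iff extensional_def fun_eq_iff)
    then have "(\<Sum>x\<in>I. f x * indicator (C x) y) = (\<Sum>x\<in>I. if x = z then f z else 0)"
      by (intro sum.cong) (auto simp: indicator_def)
    also have "\<dots> = f z" using fin z by simp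
    also have "\<dots> = f y" by (rule f) (simp add: z_def)
    finally show "(\<Sum>x\<in>I. f x * indicator (C x) y) = f y" .
  qed
  finally show ?thesis .
qed

lemma lap_cong:
  assumes "\<And>j. j < k + n \<Longrightarrow> y j = y' j"
  shows "lap y k n t = lap y' k n t"
  using assms
proof (induction n arbitrary: k t)
  case 0
  show ?case by (simp add: lap_def)
next
  case (Suc n)
  have "lap y (Suc k) n s = lap y' (Suc k) n s" for s by (rule Suc.IH) (use Suc.prems in auto)
  moreover have "y k = y' k" using Suc.prems by simp
  ultimately show ?case by (simp add: lap_Suc)
qed

lemma lap_measurable: "(\<lambda>y. lap y k n t) \<in> borel_measurable (env_space E)"
  by (rule borel_measurable_finite_coords[where N = "k + n"]) (rule lap_cong)

lemma lap_lim_measurable: "(\<lambda>y. lap_lim y t) \<in> borel_measurable (env_space E)"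
  unfolding lap_lim_def using lap_measurable by measurable

lemma degenerate_envs_measurable: "degenerate_envs \<in> sets (env_space E)"
  unfolding degenerate_envs_def using lap_lim_measurable by measurable

text \<open>Exact shift invariance makes ergodicity applicable; this is the place where ergodicity
  enters.\<close>

lemma prob_degenerate_envs:
  "measure M {\<omega>\<in>space M. env_seq \<xi> \<omega> \<in> degenerate_envs} \<in> {0, 1}"
proof -
  have "env_shift -` degenerate_envs \<inter> space (env_space E) = degenerate_envs"
    using degenerate_envs_shift by (auto simp: degenerate_envs_def)
  then have "measure (distr M (env_space E) (env_seq \<xi>)) degenerate_envs \<in> {0, 1}"
    using env_ergodic degenerate_envs_measurable unfolding ergodic_def by blast
  moreover have "measure (distr M (env_space E) (env_seq \<xi>)) degenerate_envs
    = measure M {\<omega>\<in>space M. env_seq \<xi> \<omega> \<in> degenerate_envs}"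
    by (subst measure_distr[OF env_seq_measurable degenerate_envs_measurable])
      (auto intro!: arg_cong[where f = "measure M"])
  ultimately show ?thesis by simp
qed

lemma lap_env_measurable [measurable]: "(\<lambda>\<omega>. lap (env_seq \<xi> \<omega>) k n t) \<in> borel_measurable M"
  by (rule measurable_compose[OF env_seq_measurable lap_measurable])

lemma lap_env:
  fixes \<phi> :: "nat \<Rightarrow> ennreal"
  assumes B: "B \<in> sets G"
  shows "(\<integral>\<^sup>+\<omega>\<in>B. \<phi> (Z n \<omega>) * ennreal (exp (- t * \<Pi>w n \<omega> * Wn (n + l) \<omega>)) \<partial>M)
    = (\<integral>\<^sup>+\<omega>\<in>B. \<phi> (Z n \<omega>) * lap (env_seq \<xi> \<omega>) n l t ^ Z n \<omega> \<partial>M)"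
proof -
  have eq: "(\<integral>\<^sup>+\<omega>\<in>B \<inter> cyl x (n + l). \<phi> (Z n \<omega>) * ennreal (exp (- t * \<Pi>w n \<omega> * Wn (n + l) \<omega>)) \<partial>M)
    = (\<integral>\<^sup>+\<omega>\<in>B \<inter> cyl x (n + l). \<phi> (Z n \<omega>) * lap (env_seq \<xi> \<omega>) n l t ^ Z n \<omega> \<partial>M)" for x
  proof -
    let ?s = "ennreal (exp (- t / (\<Prod>j=n..<n + l. m (x j))))"
    have "(\<integral>\<^sup>+\<omega>\<in>B \<inter> cyl x (n + l). \<phi> (Z n \<omega>) * ennreal (exp (- t * \<Pi>w n \<omega> * Wn (n + l) \<omega>)) \<partial>M)
        = (\<integral>\<^sup>+\<omega>\<in>B \<inter> cyl x (n + l). \<phi> (Z n \<omega>) * ?s ^ Z (n + l) \<omega> \<partial>M)"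
      by (intro nn_integral_cong) (use exp_Pi_Wn_on_cyl[of _ x n l "- t"] in \<open>auto simp: indicator_def\<close>)
    also have "\<dots> = (\<integral>\<^sup>+\<omega>\<in>B \<inter> cyl x (n + l). \<phi> (Z n \<omega>) * lap x n l t ^ Z n \<omega> \<partial>M)"
      unfolding lap_def using B cyl_in_G[of x "n + l"] by (intro pgf_on_cyl) auto
    also have "\<dots> = (\<integral>\<^sup>+\<omega>\<in>B \<inter> cyl x (n + l). \<phi> (Z n \<omega>) * lap (env_seq \<xi> \<omega>) n l t ^ Z n \<omega> \<partial>M)"
    proof (intro nn_integral_cong)
      fix \<omega>
      have "lap x n l t = lap (env_seq \<xi> \<omega>) n l t" if "\<omega> \<in> cyl x (n + l)"
        using that by (intro lap_cong) (auto simp: cyl_def env_seq_def)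
      then show "\<phi> (Z n \<omega>) * lap x n l t ^ Z n \<omega> * indicator (B \<inter> cyl x (n + l)) \<omega>
        = \<phi> (Z n \<omega>) * lap (env_seq \<xi> \<omega>) n l t ^ Z n \<omega> * indicator (B \<inter> cyl x (n + l)) \<omega>"
        by (auto simp: indicator_def)
    qed
    finally show ?thesis .
  qed
  have [measurable]: "(\<lambda>\<omega>. lap (env_seq \<xi> \<omega>) n l t ^ Z n \<omega>) \<in> borel_measurable M"
    by (rule measurable_compose_countable[where g = "Z n" and f = "\<lambda>k \<omega>. lap (env_seq \<xi> \<omega>) n l t ^ k"]) auto
  show ?thesis
    by (rule antisym; rule set_nn_integral_le_by_cyl[OF B, where N = "n + l"])
      (simp_all only: eq order_refl, measurable)
qed

section \<open>Degenerate environments and the converse implication\<close>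

lemma Wn_nonneg: "\<omega> \<in> space M \<Longrightarrow> Wn n \<omega> \<ge> 0"
  using Pi_pos[of \<omega> n] by (simp add: bp_W_def)

lemma env_seq_in_space: "\<omega> \<in> space M \<Longrightarrow> env_seq \<xi> \<omega> \<in> space (env_space E)"
  using measurable_space[OF env_seq_measurable] .

text \<open>The expectations of \<open>exp (- Wn l)\<close> equal those of the transforms, which
  increase to 1 when almost every environment is degenerate; they also converge to the expectation
  of \<open>exp (- W)\<close>. As \<open>W \<ge> 0\<close> almost surely, this forces
  \<open>W = 0\<close>.\<close>

lemma W_zero_if_degenerate:
  assumes deg: "measure M {\<omega>\<in>space M. env_seq \<xi> \<omega> \<in> degenerate_envs} = 1"
    and [measurable]: "W \<in> borel_measurable M"
    and lim: "AE \<omega> in M. (\<lambda>n. Wn n \<omega>) \<longlonglongrightarrow> W \<omega>"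
  shows "AE \<omega> in M. W \<omega> = 0"
proof -
  have nonneg: "AE \<omega> in M. W \<omega> \<ge> 0"
    using lim AE_space by eventually_elim (rule LIMSEQ_le_const, auto intro: Wn_nonneg)
  have "{\<omega>\<in>space M. env_seq \<xi> \<omega> \<in> degenerate_envs} \<in> sets M"
    using measurable_sets[OF env_seq_measurable degenerate_envs_measurable]
    by (simp add: vimage_def Int_def conj_commute)
  then have "AE \<omega> in M. env_seq \<xi> \<omega> \<in> degenerate_envs"
    using deg by (subst (asm) prob_eq_1) (auto elim!: eventually_mono)
  then have sup1: "AE \<omega> in M. (SUP l. lap (env_seq \<xi> \<omega>) 0 l 1) = 1"
    by eventually_elim (auto simp: degenerate_envs_def lap_lim_def dest!: spec[of _ 1])
  have int: "(\<integral>\<^sup>+\<omega>. ennreal (exp (- Wn l \<omega>)) \<partial>M) = (\<integral>\<^sup>+\<omega>. lap (env_seq \<xi> \<omega>) 0 l 1 \<partial>M)" for l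
  proof -
    have "(\<integral>\<^sup>+\<omega>. ennreal (exp (- Wn l \<omega>)) \<partial>M)
        = (\<integral>\<^sup>+\<omega>\<in>space M. 1 * ennreal (exp (- 1 * \<Pi>w 0 \<omega> * Wn (0 + l) \<omega>)) \<partial>M)"
      by (intro nn_integral_cong) (auto simp: bp_Pi_def)
    also have "\<dots> = (\<integral>\<^sup>+\<omega>\<in>space M. 1 * lap (env_seq \<xi> \<omega>) 0 l 1 ^ Z 0 \<omega> \<partial>M)"
      by (rule lap_env[OF space_in_G])
    also have "\<dots> = (\<integral>\<^sup>+\<omega>. lap (env_seq \<xi> \<omega>) 0 l 1 \<partial>M)"
      by (intro nn_integral_cong) auto
    finally show ?thesis .
  qed
  have inc: "AE \<omega> in M. lap (env_seq \<xi> \<omega>) 0 l 1 \<le> lap (env_seq \<xi> \<omega>) 0 (Suc l) 1" for l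
    using AE_space by eventually_elim
      (auto intro!: incseq_SucD[OF lap_incseq] simp: env_seq_def env_in_S)
  have "(SUP l. \<integral>\<^sup>+\<omega>. lap (env_seq \<xi> \<omega>) 0 l 1 \<partial>M) = (\<integral>\<^sup>+\<omega>. (SUP l. lap (env_seq \<xi> \<omega>) 0 l 1) \<partial>M)"
    by (rule nn_integral_monotone_convergence_SUP_AE[symmetric]) (auto intro: inc)
  also have "\<dots> = (\<integral>\<^sup>+\<omega>. 1 \<partial>M)" by (intro nn_integral_cong_AE sup1)
  also have "\<dots> = 1" by (simp add: emeasure_space_1)
  finally have "(\<lambda>l. \<integral>\<^sup>+\<omega>. lap (env_seq \<xi> \<omega>) 0 l 1 \<partial>M) \<longlonglongrightarrow> 1"
    using LIMSEQ_SUP[of "\<lambda>l. \<integral>\<^sup>+\<omega>. lap (env_seq \<xi> \<omega>) 0 l 1 \<partial>M"]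
      incseq_SucI[of "\<lambda>l. \<integral>\<^sup>+\<omega>. lap (env_seq \<xi> \<omega>) 0 l 1 \<partial>M"] nn_integral_mono_AE[OF inc] by simp
  moreover have "(\<lambda>l. \<integral>\<^sup>+\<omega>. ennreal (exp (- Wn l \<omega>)) \<partial>M) \<longlonglongrightarrow> (\<integral>\<^sup>+\<omega>. ennreal (exp (- W \<omega>)) \<partial>M)"
  proof (rule nn_integral_dominated_convergence[where w = "\<lambda>_. 1"])
    show "AE \<omega> in M. ennreal (exp (- Wn l \<omega>)) \<le> 1" for l
      using AE_space by eventually_elim (simp add: Wn_nonneg ennreal_1[symmetric] del: ennreal_1)
    show "AE \<omega> in M. (\<lambda>l. ennreal (exp (- Wn l \<omega>))) \<longlonglongrightarrow> ennreal (exp (- W \<omega>))"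
      using lim by eventually_elim (intro tendsto_intros)
  qed (auto simp: emeasure_space_1)
  ultimately have one: "(\<integral>\<^sup>+\<omega>. ennreal (exp (- W \<omega>)) \<partial>M) = 1"
    unfolding int by (rule LIMSEQ_unique[rotated])
  have le: "AE \<omega> in M. ennreal (exp (- W \<omega>)) \<le> 1"
    using nonneg by eventually_elim (simp add: ennreal_1[symmetric] del: ennreal_1)
  have "(\<integral>\<^sup>+\<omega>. 1 - ennreal (exp (- W \<omega>)) \<partial>M) = 0"
    using one le by (subst nn_integral_diff) (auto simp: emeasure_space_1)
  then have "AE \<omega> in M. 1 - ennreal (exp (- W \<omega>)) = 0"
    by (subst (asm) nn_integral_0_iff_AE) auto
  then show ?thesis using nonneg
    by eventually_elim (auto simp: diff_eq_0_iff_ennreal ennreal_1[symmetric] simp del: ennreal_1)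
qed

text \<open>A non-zero \<open>W\<close> excludes degenerate environments by the zero-one law. On
  some environment event of positive probability with \<open>\<xi> 0 = e\<close>, the transform of
  \<open>W\<close> at \<open>\<tau>\<close> given \<open>Z 1 = z\<close> is then at most
  \<open>exp (- \<tau> \<kappa> z)\<close>, and convexity transfers the exponential moment of
  \<open>W\<close> to \<open>Z 1\<close> with exponent \<open>\<theta> * \<kappa>\<close>.\<close>

lemma pgf_finite_of_exp_moment:
  assumes nz: "\<not> (AE \<omega> in M. W \<omega> = 0)" and Wm [measurable]: "W \<in> borel_measurable M"
    and lim: "AE \<omega> in M. (\<lambda>n. Wn n \<omega>) \<longlonglongrightarrow> W \<omega>"
    and \<theta>: "\<theta> > 0" "has_exp_moment M W \<theta>" and e: "e \<in> essential_states"
  shows "\<exists>\<eta>>0. pgf (p e) (ennreal (exp \<eta>)) < \<infinity>"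
proof -
  \<comment> \<open>Levels increasing to 1: a transform value below 1 lies below some level, so
    countably many events \<open>B\<close> suffice. The shift by 2 makes the smallest level
    \<open>1 / 2\<close>.\<close>
  define a where "a r = 1 - 1 / real (r + 2)" for r :: nat
  have a: "0 < a r" "a r < 1" for r by (auto simp: a_def field_simps)
  \<comment> \<open>The condition concerns the shifted environment, in which the individuals of
    generation 1 start their own processes.\<close>
  define B where "B ir = {\<omega>\<in>space M. \<xi> 0 \<omega> = e} \<inter>
    {\<omega>\<in>space M. lap_lim (env_shift (env_seq \<xi> \<omega>)) (real (fst ir)) \<le> ennreal (a (snd ir))}" for ir :: "nat \<times> nat"
  have shift: "(\<lambda>\<omega>. env_shift (env_seq \<xi> \<omega>)) \<in> measurable G (env_space E)"
    unfolding env_seq_def env_space_def env_shift_def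
    by (intro measurable_PiM_single') (auto simp: env_measurable_G env_in_S)
  have B: "B ir \<in> sets G" for ir
  proof -
    have [measurable]: "(\<lambda>\<omega>. lap_lim (env_shift (env_seq \<xi> \<omega>)) (real (fst ir))) \<in> borel_measurable G"
      by (rule measurable_compose[OF shift lap_lim_measurable])
    have "{\<omega>\<in>space G. lap_lim (env_shift (env_seq \<xi> \<omega>)) (real (fst ir)) \<le> ennreal (a (snd ir))} \<in> sets G"
      by measurable
    then show ?thesis unfolding B_def space_G using env_eq_in_G by (intro sets.Int)
  qed
  have D0: "AE \<omega> in M. env_seq \<xi> \<omega> \<notin> degenerate_envs"
  proof -
    have "{\<omega>\<in>space M. env_seq \<xi> \<omega> \<in> degenerate_envs} \<in> sets M"
      using measurable_sets[OF env_seq_measurable degenerate_envs_measurable]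
      by (simp add: vimage_def Int_def conj_commute)
    moreover have "measure M {\<omega>\<in>space M. env_seq \<xi> \<omega> \<in> degenerate_envs} = 0"
      using prob_degenerate_envs W_zero_if_degenerate[OF _ Wm lim] nz by auto
    ultimately have "{\<omega>\<in>space M. env_seq \<xi> \<omega> \<in> degenerate_envs} \<in> null_sets M"
      by (auto simp: null_sets_def emeasure_eq_measure)
    from AE_not_in[OF this] show ?thesis using AE_space by eventually_elim auto
  qed
  \<comment> \<open>If all these events were null, almost every environment with
    \<open>\<xi> 0 = e\<close> would have a degenerate shift and hence be degenerate.\<close>
  have "\<exists>ir. emeasure M (B ir) \<noteq> 0"
  proof (rule ccontr)
    assume "\<not> ?thesis"
    then have "emeasure M (B ir) = 0" for ir by blast
    then have "B ir \<in> null_sets M" for ir by (intro null_setsI sets_G_D B)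
    then have "AE \<omega> in M. \<forall>ir. \<omega> \<notin> B ir"
      by (subst AE_all_countable) (auto intro: AE_not_in)
    then have "AE \<omega> in M. \<xi> 0 \<omega> \<noteq> e"
      using D0 AE_space
    proof eventually_elim
      case (elim \<omega>)
      note sp = env_seq_in_space[OF elim(3)]
      have ssp: "env_shift (env_seq \<xi> \<omega>) \<in> space (env_space E)"
        using sp by (simp add: space_env env_shift_def)
      have "env_shift (env_seq \<xi> \<omega>) \<notin> degenerate_envs"
        using degenerate_envs_shift[OF sp] elim(2) by simp
      then obtain i :: nat where i: "lap_lim (env_shift (env_seq \<xi> \<omega>)) (real i) \<noteq> 1"
        using ssp by (auto simp: degenerate_envs_def)
      then have lt: "lap_lim (env_shift (env_seq \<xi> \<omega>)) (real i) < 1"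
        using lap_lim_le_1[OF ssp, of "real i"] by (simp add: less_le)
      then obtain v where v: "lap_lim (env_shift (env_seq \<xi> \<omega>)) (real i) = ennreal v" "0 \<le> v" "v < 1"
        by (cases "lap_lim (env_shift (env_seq \<xi> \<omega>)) (real i)") (auto simp: ennreal_1[symmetric] ennreal_less_iff simp del: ennreal_1)
      obtain r :: nat where r: "1 / (1 - v) \<le> real r" using real_arch_simple by blast
      have "1 / (1 - v) \<le> real (r + 2)" using r by simp
      then have "1 / real (r + 2) \<le> 1 - v" using v by (simp add: field_simps)
      then have "v \<le> a r" by (simp add: a_def)
      then have "lap_lim (env_shift (env_seq \<xi> \<omega>)) (real i) \<le> ennreal (a r)"
        using v by (simp add: ennreal_leI)
      moreover have "\<omega> \<notin> B (i, r)" using elim(1) by blast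
      ultimately show ?case using elim(3) by (auto simp: B_def)
    qed
    then have "\<forall>e'\<in>essential_states. e' \<noteq> e" by (rule AE_env_iff[THEN iffD1])
    then show False using e by blast
  qed
  then obtain i r where pos: "emeasure M (B (i, r)) \<noteq> 0" by auto
  let ?B = "B (i, r)"
  let ?a = "a r"
  have BG: "?B \<in> sets G" by (rule B)
  then have [measurable]: "?B \<in> sets M" by auto
  have eS: "e \<in> S" using e by (simp add: essential_states_def)
  have me: "m e > 0" using mean_positive eS by simp
  have BD: "\<omega> \<in> space M" "\<xi> 0 \<omega> = e" "lap_lim (env_shift (env_seq \<xi> \<omega>)) (real i) \<le> ennreal ?a"
    if "\<omega> \<in> ?B" for \<omega> using that by (auto simp: B_def)
  \<comment> \<open>At argument 0 the transform is at least 1 and exceeds every level, so a non-null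
    event has \<open>i > 0\<close>.\<close>
  have i0: "i > 0"
  proof (rule ccontr)
    assume "\<not> i > 0"
    then have i: "i = 0" by simp
    have "?B = {}"
    proof (rule equals0I)
      fix \<omega> assume \<omega>: "\<omega> \<in> ?B"
      have "(1::ennreal) = lap (env_shift (env_seq \<xi> \<omega>)) 0 0 0" by (simp add: lap_def)
      also have "\<dots> \<le> lap_lim (env_shift (env_seq \<xi> \<omega>)) 0" unfolding lap_lim_def by (rule SUP_upper) simp
      also have "\<dots> \<le> ennreal ?a" using BD(3)[OF \<omega>] i by simp
      finally show False using a[of r] by (simp add: ennreal_1[symmetric] del: ennreal_1)
    qed
    then show False using pos by simp
  qed
  \<comment> \<open>As \<open>\<Pi>w 1\<close> equals \<open>m e\<close> on the event, argument
    \<open>i\<close> for the processes started in generation 1 corresponds to \<open>\<tau>\<close>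
    for \<open>W\<close>.\<close>
  define \<tau> where "\<tau> = real i * m e"
  have \<tau>: "\<tau> > 0" using i0 me by (simp add: \<tau>_def)
  \<comment> \<open>Rewrites powers of the level as \<open>exp (- \<tau> \<kappa> z)\<close>, so
    that the transform bound compares \<open>W\<close> with \<open>\<kappa> * Z 1\<close>.\<close>
  define \<kappa> where "\<kappa> = - ln ?a / \<tau>"
  have \<kappa>: "\<kappa> > 0" using a[of r] \<tau> by (simp add: \<kappa>_def divide_neg_pos)
  have a_exp: "?a ^ z = exp (- \<tau> * (\<kappa> * real z))" for z
  proof -
    have "- \<tau> * (\<kappa> * real z) = real z * ln ?a" using \<tau> by (simp add: \<kappa>_def)
    then show ?thesis using a[of r] by (simp add: exp_of_nat_mult)
  qed
  \<comment> \<open>Each of the \<open>Z 1\<close> subtrees contributes one factor, at most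
    \<open>?a\<close> uniformly in \<open>l\<close> since \<open>lap \<le> lap_lim\<close>.
    Finiteness of the weights keeps the limit of the products legitimate.\<close>
  have lap_bound: "(\<integral>\<^sup>+\<omega>\<in>?B. \<phi> (Z 1 \<omega>) * ennreal (exp (- \<tau> * W \<omega>)) \<partial>M)
    \<le> (\<integral>\<^sup>+\<omega>\<in>?B. \<phi> (Z 1 \<omega>) * ennreal (?a ^ Z 1 \<omega>) \<partial>M)" if \<phi>: "\<And>z. \<phi> z < \<infinity>" for \<phi> :: "nat \<Rightarrow> ennreal"
  proof (rule nn_integral_le_liminf_bound)
    show "(\<lambda>\<omega>. \<phi> (Z 1 \<omega>) * ennreal (exp (- \<tau> * Wn (1 + l) \<omega>)) * indicator ?B \<omega>) \<in> borel_measurable M" for l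
      by measurable
    show "AE \<omega> in M. \<phi> (Z 1 \<omega>) * ennreal (exp (- \<tau> * W \<omega>)) * indicator ?B \<omega>
      \<le> liminf (\<lambda>l. \<phi> (Z 1 \<omega>) * ennreal (exp (- \<tau> * Wn (1 + l) \<omega>)) * indicator ?B \<omega>)"
      using lim
    proof eventually_elim
      case (elim \<omega>)
      have "(\<lambda>l. Wn (1 + l) \<omega>) \<longlonglongrightarrow> W \<omega>" using LIMSEQ_ignore_initial_segment[OF elim, of 1] by simp
      then have "(\<lambda>l. ennreal (exp (- \<tau> * Wn (1 + l) \<omega>))) \<longlonglongrightarrow> ennreal (exp (- \<tau> * W \<omega>))"
        by (intro tendsto_intros)
      then have "(\<lambda>l. \<phi> (Z 1 \<omega>) * ennreal (exp (- \<tau> * Wn (1 + l) \<omega>)) * indicator ?B \<omega>)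
          \<longlonglongrightarrow> \<phi> (Z 1 \<omega>) * ennreal (exp (- \<tau> * W \<omega>)) * indicator ?B \<omega>"
        using \<phi>[of "Z 1 \<omega>"]
        by (intro tendsto_mult_ennreal tendsto_const) (auto simp: ennreal_mult_eq_top_iff indicator_def split: if_splits)
      from lim_imp_Liminf[OF sequentially_bot this] show ?case by simp
    qed
    show "(\<integral>\<^sup>+\<omega>\<in>?B. \<phi> (Z 1 \<omega>) * ennreal (exp (- \<tau> * Wn (1 + l) \<omega>)) \<partial>M)
      \<le> (\<integral>\<^sup>+\<omega>\<in>?B. \<phi> (Z 1 \<omega>) * ennreal (?a ^ Z 1 \<omega>) \<partial>M)" for l
    proof -
      have "(\<integral>\<^sup>+\<omega>\<in>?B. \<phi> (Z 1 \<omega>) * ennreal (exp (- \<tau> * Wn (1 + l) \<omega>)) \<partial>M)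
          = (\<integral>\<^sup>+\<omega>\<in>?B. \<phi> (Z 1 \<omega>) * ennreal (exp (- real i * \<Pi>w 1 \<omega> * Wn (1 + l) \<omega>)) \<partial>M)"
        using BD(2) by (intro nn_integral_cong) (auto simp: indicator_def bp_Pi_def env_mean_def \<tau>_def)
      also have "\<dots> = (\<integral>\<^sup>+\<omega>\<in>?B. \<phi> (Z 1 \<omega>) * lap (env_seq \<xi> \<omega>) 1 l (real i) ^ Z 1 \<omega> \<partial>M)"
        by (rule lap_env[OF BG])
      also have "\<dots> \<le> (\<integral>\<^sup>+\<omega>\<in>?B. \<phi> (Z 1 \<omega>) * ennreal (?a ^ Z 1 \<omega>) \<partial>M)"
      proof (intro nn_integral_mono)
        fix \<omega>
        have "lap (env_seq \<xi> \<omega>) 1 l (real i) \<le> ennreal ?a" if "\<omega> \<in> ?B"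
        proof -
          have "lap (env_seq \<xi> \<omega>) 1 l (real i) = lap (env_shift (env_seq \<xi> \<omega>)) 0 l (real i)"
            by (simp add: lap_shift)
          also have "\<dots> \<le> lap_lim (env_shift (env_seq \<xi> \<omega>)) (real i)"
            unfolding lap_lim_def by (rule SUP_upper) simp
          finally show ?thesis using BD(3)[OF that] by simp
        qed
        then have "lap (env_seq \<xi> \<omega>) 1 l (real i) ^ Z 1 \<omega> \<le> ennreal (?a ^ Z 1 \<omega>)" if "\<omega> \<in> ?B"
          using that a[of r] by (subst ennreal_power[symmetric]) (auto intro!: power_mono)
        then show "\<phi> (Z 1 \<omega>) * lap (env_seq \<xi> \<omega>) 1 l (real i) ^ Z 1 \<omega> * indicator ?B \<omega>
          \<le> \<phi> (Z 1 \<omega>) * ennreal (?a ^ Z 1 \<omega>) * indicator ?B \<omega>"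
          by (auto simp: indicator_def intro!: mult_left_mono)
      qed
      finally show ?thesis .
    qed
  qed
  let ?T = "\<integral>\<^sup>+\<omega>. ennreal (exp (\<theta> * W \<omega>)) \<partial>M"
  \<comment> \<open>The truncation at \<open>K\<close> makes the auxiliary integral
    \<open>?Y\<close> finite, so that it can be subtracted.\<close>
  have trunc: "(\<integral>\<^sup>+\<omega>\<in>?B. ennreal (of_bool (Z 1 \<omega> \<le> K) * exp (\<theta> * \<kappa> * real (Z 1 \<omega>))) \<partial>M) \<le> ?T" for K
  proof -
    define \<psi> where "\<psi> z = of_bool (z \<le> K) * exp (\<theta> * \<kappa> * real z)" for z :: nat
    \<comment> \<open>Tuned so that replacing \<open>exp (- \<tau> * W \<omega>)\<close> by
      \<open>?a ^ Z 1 \<omega>\<close> turns the weighted integral into \<open>?Y\<close>.\<close>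
    define \<phi> where "\<phi> z = ennreal (\<theta> / \<tau> * \<psi> z / ?a ^ z)" for z
    have \<psi>0: "\<psi> z \<ge> 0" for z by (simp add: \<psi>_def)
    have \<psi>K: "\<psi> z \<le> exp (\<theta> * \<kappa> * real K)" for z
      using \<theta> \<kappa> by (auto simp: \<psi>_def)
    let ?Y = "\<integral>\<^sup>+\<omega>\<in>?B. ennreal (\<theta> / \<tau> * \<psi> (Z 1 \<omega>)) \<partial>M"
    have "?Y \<le> (\<integral>\<^sup>+\<omega>. ennreal (\<theta> / \<tau> * exp (\<theta> * \<kappa> * real K)) \<partial>M)"
      using \<psi>K \<theta> \<tau> by (intro nn_integral_mono) (auto simp: indicator_def intro!: ennreal_leI mult_left_mono divide_right_mono)
    also have "\<dots> < \<infinity>" by (simp add: emeasure_space_1)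
    finally have Yfin: "?Y < \<infinity>" .
    have pt: "\<psi> z + \<theta> / \<tau> * \<psi> z \<le> exp (\<theta> * w) + \<theta> / \<tau> * \<psi> z / ?a ^ z * exp (- \<tau> * w)" for z w
    proof (cases "z \<le> K")
      case True
      \<comment> \<open>Jensen's inequality in pointwise form: \<open>exp (\<theta> u) \<ge> 1 +
        \<theta> u \<ge> 1 + \<theta> (1 - exp (- \<tau> u)) / \<tau>\<close>. Weighted by
        \<open>\<psi>\<close>, the last term has a non-negative integral by
        \<open>lap_bound\<close>.\<close>
      define u where "u = w - \<kappa> * real z"
      have "1 - exp (- \<tau> * u) \<le> \<tau> * u" using exp_ge_add_one_self[of "- \<tau> * u"] by linarith
      then have "(1 - exp (- \<tau> * u)) / \<tau> \<le> u" using \<tau> by (simp add: field_simps)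
      then have "1 + \<theta> * ((1 - exp (- \<tau> * u)) / \<tau>) \<le> 1 + \<theta> * u"
        using \<theta> by (intro add_left_mono mult_left_mono) auto
      also have "\<dots> \<le> exp (\<theta> * u)" by (rule exp_ge_add_one_self)
      finally have "1 + \<theta> / \<tau> \<le> exp (\<theta> * u) + \<theta> / \<tau> * exp (- \<tau> * u)"
        by (simp add: field_simps diff_divide_distrib)
      then have "exp (\<theta> * \<kappa> * real z) * (1 + \<theta> / \<tau>)
          \<le> exp (\<theta> * \<kappa> * real z) * (exp (\<theta> * u) + \<theta> / \<tau> * exp (- \<tau> * u))"
        by (intro mult_left_mono) auto
      moreover have "exp (\<theta> * \<kappa> * real z) * exp (\<theta> * u) = exp (\<theta> * w)"
        by (simp add: exp_add[symmetric] u_def algebra_simps)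
      moreover have "exp (- \<tau> * w) / ?a ^ z = exp (- \<tau> * u)"
        unfolding a_exp by (simp add: exp_diff[symmetric] u_def algebra_simps)
      then have "\<theta> / \<tau> * \<psi> z / ?a ^ z * exp (- \<tau> * w) = \<theta> / \<tau> * \<psi> z * exp (- \<tau> * u)"
        by (metis times_divide_eq_left times_divide_eq_right)
      moreover have "\<psi> z = exp (\<theta> * \<kappa> * real z)" using True by (simp add: \<psi>_def)
      ultimately show ?thesis by (simp add: distrib_left distrib_right mult_ac)
    qed (simp add: \<psi>_def)
    have "(\<integral>\<^sup>+\<omega>\<in>?B. ennreal (\<psi> (Z 1 \<omega>)) \<partial>M) + ?Y
       = (\<integral>\<^sup>+\<omega>\<in>?B. ennreal (\<psi> (Z 1 \<omega>) + \<theta> / \<tau> * \<psi> (Z 1 \<omega>)) \<partial>M)"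
      using \<psi>0 \<theta> \<tau> by (subst nn_integral_add[symmetric]) (auto intro!: nn_integral_cong simp: indicator_def)
    also have "\<dots> \<le> (\<integral>\<^sup>+\<omega>\<in>?B. ennreal (exp (\<theta> * W \<omega>) + \<theta> / \<tau> * \<psi> (Z 1 \<omega>) / ?a ^ Z 1 \<omega> * exp (- \<tau> * W \<omega>)) \<partial>M)"
      using pt by (intro nn_integral_mono mult_right_mono ennreal_leI) auto
    also have "\<dots> = (\<integral>\<^sup>+\<omega>\<in>?B. ennreal (exp (\<theta> * W \<omega>)) \<partial>M)
        + (\<integral>\<^sup>+\<omega>\<in>?B. \<phi> (Z 1 \<omega>) * ennreal (exp (- \<tau> * W \<omega>)) \<partial>M)"
      using \<psi>0 \<theta> \<tau> a[of r]
      by (subst nn_integral_add[symmetric]) (auto intro!: nn_integral_cong simp: indicator_def \<phi>_def ennreal_mult[symmetric])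
    also have "\<dots> \<le> ?T + (\<integral>\<^sup>+\<omega>\<in>?B. \<phi> (Z 1 \<omega>) * ennreal (?a ^ Z 1 \<omega>) \<partial>M)"
    proof (rule add_mono)
      show "(\<integral>\<^sup>+\<omega>\<in>?B. ennreal (exp (\<theta> * W \<omega>)) \<partial>M) \<le> ?T"
        by (intro nn_integral_mono) (auto simp: indicator_def)
    qed (intro lap_bound, simp add: \<phi>_def)
    also have "(\<integral>\<^sup>+\<omega>\<in>?B. \<phi> (Z 1 \<omega>) * ennreal (?a ^ Z 1 \<omega>) \<partial>M) = ?Y"
      using \<psi>0 \<theta> \<tau> a[of r] by (intro nn_integral_cong) (auto simp: \<phi>_def indicator_def ennreal_mult[symmetric])
    finally have "(\<integral>\<^sup>+\<omega>\<in>?B. ennreal (\<psi> (Z 1 \<omega>)) \<partial>M) \<le> ?T"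
      using Yfin by (auto simp: ennreal_add_left_cancel_le add.commute[of _ ?Y])
    then show ?thesis by (simp add: \<psi>_def)
  qed
  \<comment> \<open>Fatou's lemma removes the truncation; for \<open>K \<ge> Z 1 \<omega>\<close>
    the truncated integrand is the full one.\<close>
  have "(\<integral>\<^sup>+\<omega>\<in>?B. ennreal (exp (\<theta> * \<kappa>)) ^ Z (0 + 1) \<omega> \<partial>M) \<le> ?T"
  proof (rule nn_integral_le_liminf_bound[OF _ _ trunc])
    show "(\<lambda>\<omega>. ennreal (of_bool (Z 1 \<omega> \<le> K) * exp (\<theta> * \<kappa> * real (Z 1 \<omega>))) * indicator ?B \<omega>) \<in> borel_measurable M" for K
      by measurable
    show "AE \<omega> in M. ennreal (exp (\<theta> * \<kappa>)) ^ Z (0 + 1) \<omega> * indicator ?B \<omega>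
      \<le> liminf (\<lambda>K. ennreal (of_bool (Z 1 \<omega> \<le> K) * exp (\<theta> * \<kappa> * real (Z 1 \<omega>))) * indicator ?B \<omega>)"
    proof (intro AE_I2 Liminf_bounded)
      fix \<omega>
      show "\<forall>\<^sub>F K in sequentially. ennreal (exp (\<theta> * \<kappa>)) ^ Z (0 + 1) \<omega> * indicator ?B \<omega>
        \<le> ennreal (of_bool (Z 1 \<omega> \<le> K) * exp (\<theta> * \<kappa> * real (Z 1 \<omega>))) * indicator ?B \<omega>"
        using eventually_ge_at_top[of "Z 1 \<omega>"]
        by eventually_elim (simp add: ennreal_power exp_of_nat_mult[symmetric] mult.commute)
    qed
  qed
  also have "?T < \<infinity>" using \<theta> by (simp add: has_exp_moment_def)
  finally have fin: "(\<integral>\<^sup>+\<omega>\<in>?B. ennreal (exp (\<theta> * \<kappa>)) ^ Z (0 + 1) \<omega> \<partial>M) < \<infinity>" .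
  have "(\<integral>\<^sup>+\<omega>\<in>?B. ennreal (exp (\<theta> * \<kappa>)) ^ Z (0 + 1) \<omega> \<partial>M)
      = (\<integral>\<^sup>+\<omega>\<in>?B. pgf (p e) (ennreal (exp (\<theta> * \<kappa>))) \<partial>M)"
    using pgf_on_cyl[OF BG, of "\<lambda>_. e" 0 1 "\<lambda>_. 1"] BD by (simp add: cyl_def subset_iff)
  also have "\<dots> = pgf (p e) (ennreal (exp (\<theta> * \<kappa>))) * emeasure M ?B"
    by (intro nn_integral_cmult_indicator) auto
  finally have "pgf (p e) (ennreal (exp (\<theta> * \<kappa>))) < \<infinity>"
    using fin pos by (auto simp: ennreal_mult_less_top)
  then show ?thesis using \<theta> \<kappa> by (intro exI[of _ "\<theta> * \<kappa>"]) auto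
qed

text \<open>The exponents rescaled by the means have a positive minimum over the finitely many
  states, and the sum \<open>K\<close> dominates the transform at each of them.\<close>

lemma exp_moment_W1:
  assumes "\<And>e. e \<in> essential_states \<Longrightarrow> \<exists>\<eta>>0. pgf (p e) (ennreal (exp \<eta>)) < \<infinity>"
  shows "\<exists>\<theta>>0. has_exp_moment M (Wn 1) \<theta>"
proof -
  obtain \<eta> where \<eta>: "\<And>e. e \<in> essential_states \<Longrightarrow> \<eta> e > 0"
    "\<And>e. e \<in> essential_states \<Longrightarrow> pgf (p e) (ennreal (exp (\<eta> e))) < \<infinity>"
    using assms by metis
  have mpos: "m e > 0" if "e \<in> essential_states" for e
    using that mean_positive by (simp add: essential_states_def)
  define \<theta> where "\<theta> = Min ((\<lambda>e. \<eta> e * m e) ` essential_states)"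
  have \<theta>: "\<theta> > 0"
    unfolding \<theta>_def using \<eta>(1) mpos finite_essential_states essential_states_nonempty by simp
  have \<theta>le: "\<theta> / m e \<le> \<eta> e" if "e \<in> essential_states" for e
  proof -
    have "\<theta> \<le> \<eta> e * m e" unfolding \<theta>_def using that finite_essential_states by simp
    then show ?thesis using mpos[OF that] by (simp add: pos_divide_le_eq)
  qed
  define K where "K = (\<Sum>e\<in>essential_states. pgf (p e) (ennreal (exp (\<eta> e))))"
  have "(\<integral>\<^sup>+\<omega>\<in>space M. ennreal (exp (\<theta> * Wn 1 \<omega>)) \<partial>M) \<le> (\<integral>\<^sup>+\<omega>\<in>space M. K \<partial>M)"
  proof (rule set_nn_integral_le_by_cyl[OF space_in_G, where N = 1])
    fix x
    have eq: "space M \<inter> cyl x 1 = cyl x 1" by (auto simp: cyl_def)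
    show "(\<integral>\<^sup>+\<omega>\<in>space M \<inter> cyl x 1. ennreal (exp (\<theta> * Wn 1 \<omega>)) \<partial>M) \<le> (\<integral>\<^sup>+\<omega>\<in>space M \<inter> cyl x 1. K \<partial>M)"
    proof (cases "x 0 \<in> essential_states")
      case False
      then have "cyl x 1 \<in> null_sets M"
        using null_cyl_of_inessential[of 0 1 x] cyl_in_G[of x 1] by (auto simp: null_sets_def)
      then have "AE \<omega> in M. \<omega> \<notin> cyl x 1" by (rule AE_not_in)
      then have "(\<integral>\<^sup>+\<omega>\<in>cyl x 1. f \<omega> \<partial>M) = 0" for f :: "'a \<Rightarrow> ennreal"
        by (subst nn_integral_cong_AE[where v = "\<lambda>_. 0"]) (auto elim!: eventually_mono)
      then show ?thesis unfolding eq by simp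
    next
      case True
      have "(\<integral>\<^sup>+\<omega>\<in>cyl x 1. ennreal (exp (\<theta> * Wn 1 \<omega>)) \<partial>M)
          = (\<integral>\<^sup>+\<omega>\<in>cyl x 1. ennreal (exp (\<theta> / m (x 0))) ^ Z (0 + 1) \<omega> \<partial>M)"
        by (intro nn_integral_cong)
          (auto simp: indicator_def cyl_def bp_W_def bp_Pi_def env_mean_def ennreal_power exp_of_nat_mult[symmetric] mult.commute)
      also have "\<dots> = (\<integral>\<^sup>+\<omega>\<in>cyl x 1. pgf (p (x 0)) (ennreal (exp (\<theta> / m (x 0)))) \<partial>M)"
        using pgf_on_cyl[OF cyl_in_G, of x 1 x 0 1 "\<lambda>_. 1"] by simp
      also have "\<dots> \<le> (\<integral>\<^sup>+\<omega>\<in>cyl x 1. K \<partial>M)"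
      proof -
        have "pgf (p (x 0)) (ennreal (exp (\<theta> / m (x 0)))) \<le> pgf (p (x 0)) (ennreal (exp (\<eta> (x 0))))"
          using \<theta>le[OF True] by (intro pgf_mono ennreal_leI) simp
        also have "\<dots> \<le> K"
          unfolding K_def using True finite_essential_states by (intro sum_nonneg_leq_bound[OF _ _ refl]) auto
        finally show ?thesis by (intro nn_integral_mono mult_right_mono) auto
      qed
      finally show ?thesis unfolding eq .
    qed
  qed auto
  also have "\<dots> = K" by (subst nn_integral_cmult_indicator) (auto simp: emeasure_space_1)
  also have "\<dots> < \<infinity>" unfolding K_def using \<eta>(2) finite_essential_states by simp
  finally have "(\<integral>\<^sup>+\<omega>\<in>space M. ennreal (exp (\<theta> * Wn 1 \<omega>)) \<partial>M) < \<infinity>" .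
  moreover have "(\<integral>\<^sup>+\<omega>\<in>space M. ennreal (exp (\<theta> * Wn 1 \<omega>)) \<partial>M) = (\<integral>\<^sup>+\<omega>. ennreal (exp (\<theta> * Wn 1 \<omega>)) \<partial>M)"
    by (intro nn_integral_cong) auto
  ultimately show ?thesis using \<theta> unfolding has_exp_moment_def by auto
qed

end

text \<open>The direction from \<open>W\<close> to \<open>bp_W \<xi> p X 1\<close> in (a) is
  confined to \<open>W\<close> not almost surely 0: a vanishing \<open>W\<close> has every
  exponential moment, whatever the offspring laws are.\<close>

theorem theorem1p4:
  fixes M :: "'a measure" and E :: "'e measure" and S :: "'e set"
    and \<xi> :: "nat \<Rightarrow> 'a \<Rightarrow> 'e" and p :: "'e \<Rightarrow> nat pmf"
    and X :: "nat \<Rightarrow> nat \<Rightarrow> 'a \<Rightarrow> nat" and W :: "'a \<Rightarrow> real"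
  assumes bpre: "branching_process_random_env M E \<xi> p X"
    and finite_states: "finite S" "E = count_space S"
    and p0: "AE \<omega> in M. pmf (p (\<xi> 0 \<omega>)) 0 = 0"
    and p1: "AE \<omega> in M. pmf (p (\<xi> 0 \<omega>)) 1 < 1"
    and W_measurable: "W \<in> borel_measurable M"
    and W_limit: "AE \<omega> in M. (\<lambda>n. bp_W \<xi> p X n \<omega>) \<longlonglongrightarrow> W \<omega>"
  shows "(\<not> (AE \<omega> in M. W \<omega> = 0) \<longrightarrow>
            ((\<exists>\<theta>>0. has_exp_moment M W \<theta>) \<longleftrightarrow> (\<exists>\<theta>\<^sub>0>0. has_exp_moment M (bp_W \<xi> p X 1) \<theta>\<^sub>0)))
       \<and> ((\<exists>\<theta>\<^sub>0>0. has_exp_moment M (bp_W \<xi> p X 1) \<theta>\<^sub>0) \<longrightarrow> (\<exists>\<theta>>0. has_exp_moment M W \<theta>))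
       \<and> essinf M (env_mean \<xi> p 0) > 1
       \<and> ((\<exists>\<theta>\<^sub>0>0. has_exp_moment M (bp_W \<xi> p X 1) \<theta>\<^sub>0) \<longrightarrow>
            (\<exists>\<gamma>>0. \<exists>C>0. \<forall>n. \<forall>\<epsilon>>0.
               (AE \<omega> in M.
                  quenched_prob M E \<xi> {\<omega>'\<in>space M. \<bar>W \<omega>' - bp_W \<xi> p X n \<omega>'\<bar> > \<epsilon>} \<omega>
                    \<le> C * exp (- \<gamma> * bp_Pi \<xi> p n \<omega> powr (1/3) * \<epsilon> powr (2/3)))
             \<and> measure M {\<omega>\<in>space M. \<bar>W \<omega> - bp_W \<xi> p X n \<omega>\<bar> > \<epsilon>}
                    \<le> C * exp (- \<gamma> * essinf M (env_mean \<xi> p 0) powr (real n / 3) * \<epsilon> powr (2/3))))"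
proof -
  interpret finite_env_branching M E \<xi> p X S
    using bpre finite_states by (simp add: finite_env_branching_def finite_env_branching_axioms_def)
  have m1: "mean_offspring (p e) > 1" if "e \<in> essential_states" for e
  proof (rule mean_offspring_gt_1)
    show "summable (\<lambda>i. real i * pmf (p e) i)"
      using that mean_finite by (simp add: essential_states_def)
    show "pmf (p e) 0 = 0" "pmf (p e) 1 < 1"
      using that p0 p1 unfolding AE_env_iff[of "\<lambda>e. pmf (p e) 0 = 0"] AE_env_iff[of "\<lambda>e. pmf (p e) 1 < 1"] by auto
  qed
  have essinf: "essinf M (env_mean \<xi> p 0) > 1"
    unfolding essinf_eq_Min using m1 finite_essential_states essential_states_nonempty by simp
  have ctrl: "\<exists>c D. mgf_controlled c D" if "\<exists>\<theta>\<^sub>0>0. has_exp_moment M (bp_W \<xi> p X 1) \<theta>\<^sub>0"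
    using that ex_mgf_controlled[OF m1] by blast
  have forward: "\<exists>\<theta>>0. has_exp_moment M W \<theta>" if "\<exists>\<theta>\<^sub>0>0. has_exp_moment M (bp_W \<xi> p X 1) \<theta>\<^sub>0"
    using ctrl[OF that] exp_moment_limit[OF _ W_limit] by (auto simp: mgf_controlled_def)
  have backward: "\<exists>\<theta>\<^sub>0>0. has_exp_moment M (bp_W \<xi> p X 1) \<theta>\<^sub>0"
    if "\<not> (AE \<omega> in M. W \<omega> = 0)" "\<exists>\<theta>>0. has_exp_moment M W \<theta>"
    using that pgf_finite_of_exp_moment[OF _ W_measurable W_limit] by (intro exp_moment_W1) blast
  have tail: "\<exists>\<gamma>>0. \<exists>C>0. \<forall>n. \<forall>\<epsilon>>0.
       (AE \<omega> in M.
          quenched_prob M E \<xi> {\<omega>'\<in>space M. \<bar>W \<omega>' - bp_W \<xi> p X n \<omega>'\<bar> > \<epsilon>} \<omega>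
            \<le> C * exp (- \<gamma> * bp_Pi \<xi> p n \<omega> powr (1/3) * \<epsilon> powr (2/3)))
     \<and> measure M {\<omega>\<in>space M. \<bar>W \<omega> - bp_W \<xi> p X n \<omega>\<bar> > \<epsilon>}
            \<le> C * exp (- \<gamma> * essinf M (env_mean \<xi> p 0) powr (real n / 3) * \<epsilon> powr (2/3))"
    if W1: "\<exists>\<theta>\<^sub>0>0. has_exp_moment M (bp_W \<xi> p X 1) \<theta>\<^sub>0"
  proof -
    obtain c D where c: "mgf_controlled c D" using ctrl[OF W1] by blast
    have "c > 0" using c by (simp add: mgf_controlled_def)
    moreover have "tail_const c D > 0" by (simp add: tail_const_def less_max_iff_disj)
    ultimately show ?thesis
      using concentration[OF m1 c _ W_measurable W_limit] by blast
  qed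
  show ?thesis using essinf forward backward tail by blast
qed

end
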